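(* Let $\mathcal{H}_1,\mathcal{H}_2$ be finite-dimensional complex Hilbert spaces, let $\rho_{12}$ be a density matrix on $\mathcal{H}_1\otimes\mathcal{H}_2$, and let $\rho_1$ and $\rho_2$ be its reduced density matrices on $\mathcal{H}_1$ and $\mathcal{H}_2$, respectively. Then $$S(\rho_{12})-S(\rho_1)-S(\rho_2)\;\leq\;2\ln\left(1-\tfrac12\,\mathrm{Tr}\left[\sqrt{\rho_{12}}-\sqrt{\rho_1\otimes\rho_2}\right]^2\right).$$ In particular, $S(\rho_1)+S(\rho_2)-S(\rho_{12})\geq 0$, with equality if and only if $\rho_{12}=\rho_1\otimes\rho_2$. More generally, if $\rho_{1\cdots N}$ is a density matrix on $\mathcal{H}_1\otimes\cdots\otimes\mathcal{H}_N$, where $\mathcal{H}_1,\dots,\mathcal{H}_N$ are finite-dimensional complex Hilbert spaces, and $\rho_j$ is its reduced density matrix on $\mathcal{H}_j$, then $$S(\rho_{1\cdots N})-\sum_{j=1}^N S(\rho_j)\;\leq\;2\ln\left(1-\tfrac12\,\mathrm{Tr}\left[\sqrt{\rho_{1\cdots N}}-\sqrt{\rho_1\otimes\cdots\otimes\rho_N}\right]^2\right).$$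
   Context: A density matrix is a positive semidefinite operator of trace $1$. The reduced density matrix on $\mathcal{H}_j$ is the partial trace over all other tensor factors. $S(\rho)=-\mathrm{Tr}(\rho\ln\rho)$ is the von Neumann entropy, with $0\ln 0=0$. $\mathrm{Tr}[X]^2$ means $\mathrm{Tr}(X^2)$. No symmetry or statistics assumption is made on the states. *)

theory Defs
  imports Complex_Main "Jordan_Normal_Form.Schur_Decomposition"
begin

text \<open>
  A finite-dimensional complex Hilbert space of dimension \<open>d\<close> is represented by \<open>\<complex>\<^sup>d\<close>, and operators
  on it by matrices in \<open>carrier_mat d d\<close>. The space \<open>\<complex>\<^sup>m \<otimes> \<complex>\<^sup>n\<close> is \<open>\<complex>\<^bsup>m * n\<^esup>\<close>, where the basis vector
  \<open>e\<^sub>i \<otimes> e\<^sub>k\<close> has index \<open>i * n + k\<close>.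
\<close>

definition mat_trace :: "complex mat \<Rightarrow> complex" where
  "mat_trace A = (\<Sum>i<dim_row A. A $$ (i, i))"

definition positive_semidefinite :: "nat \<Rightarrow> complex mat \<Rightarrow> bool" where
  "positive_semidefinite n A \<longleftrightarrow> A \<in> carrier_mat n n \<and> mat_adjoint A = A \<and>
     (\<forall>v \<in> carrier_vec n. 0 \<le> Re ((A *\<^sub>v v) \<bullet>c v))"

definition density_matrix :: "nat \<Rightarrow> complex mat \<Rightarrow> bool" where
  "density_matrix n \<rho> \<longleftrightarrow> positive_semidefinite n \<rho> \<and> mat_trace \<rho> = 1"

definition unitary_mat :: "nat \<Rightarrow> complex mat \<Rightarrow> bool" where
  "unitary_mat n U \<longleftrightarrow> U \<in> carrier_mat n n \<and> mat_adjoint U * U = 1\<^sub>m n \<and> U * mat_adjoint U = 1\<^sub>m n"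

definition real_diag :: "nat \<Rightarrow> (nat \<Rightarrow> real) \<Rightarrow> complex mat" where
  "real_diag n d = mat_diag n (\<lambda>i. complex_of_real (d i))"

text \<open>
  Functional calculus for self-adjoint matrices through a unitary diagonalization; the result does
  not depend on the diagonalization (lemma \<open>mat_fun_eqI\<close>).
\<close>

definition mat_fun :: "(real \<Rightarrow> real) \<Rightarrow> complex mat \<Rightarrow> complex mat" where
  "mat_fun f A = (THE B. \<exists>U d. unitary_mat (dim_row A) U \<and>
     A = U * real_diag (dim_row A) d * mat_adjoint U \<and>
     B = U * real_diag (dim_row A) (\<lambda>i. f (d i)) * mat_adjoint U)"

definition mat_sqrt :: "complex mat \<Rightarrow> complex mat" where
  "mat_sqrt = mat_fun sqrt"

text \<open>
  The convention \<open>0 ln 0 = 0\<close> holds automatically, since \<open>0 * ln 0 = 0\<close>. The trace below is real for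
  self-adjoint \<open>\<rho>\<close>.
\<close>

definition vn_entropy :: "complex mat \<Rightarrow> real" where
  "vn_entropy \<rho> = - Re (mat_trace (mat_fun (\<lambda>x. x * ln x) \<rho>))"

definition kron :: "complex mat \<Rightarrow> complex mat \<Rightarrow> complex mat" (infixr "\<otimes>\<^sub>m" 70) where
  "A \<otimes>\<^sub>m B = mat (dim_row A * dim_row B) (dim_col A * dim_col B)
     (\<lambda>(i, j). A $$ (i div dim_row B, j div dim_col B) * B $$ (i mod dim_row B, j mod dim_col B))"

fun kron_list :: "complex mat list \<Rightarrow> complex mat" where
  "kron_list [] = 1\<^sub>m 1"
| "kron_list (A # As) = A \<otimes>\<^sub>m kron_list As"

text \<open>Reduced matrices on the first factor (the second one traced out) and on the second factor.\<close>

definition reduced_fst :: "nat \<Rightarrow> nat \<Rightarrow> complex mat \<Rightarrow> complex mat" where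
  "reduced_fst m n \<rho> = mat m m (\<lambda>(i, j). \<Sum>k<n. \<rho> $$ (i * n + k, j * n + k))"

definition reduced_snd :: "nat \<Rightarrow> nat \<Rightarrow> complex mat \<Rightarrow> complex mat" where
  "reduced_snd m n \<rho> = mat n n (\<lambda>(k, l). \<Sum>i<m. \<rho> $$ (i * n + k, i * n + l))"

text \<open>
  Reduced matrix on factor \<open>j\<close> (counted from \<open>0\<close>) of a space whose factors have the dimensions
  \<open>ds\<close>: the factors before \<open>j\<close> and those after \<open>j\<close> are grouped and traced out.
\<close>

definition reduced :: "nat list \<Rightarrow> nat \<Rightarrow> complex mat \<Rightarrow> complex mat" where
  "reduced ds j \<rho> =
     (let l = prod_list (take j ds); r = prod_list (drop (Suc j) ds)
      in reduced_fst (ds ! j) r (reduced_snd l (ds ! j * r) \<rho>))"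

lemma mat_adjoint_dim [simp]:
  "dim_row (mat_adjoint A) = dim_col A" "dim_col (mat_adjoint A) = dim_row A"
  by (auto simp: mat_adjoint_def)

lemma real_diag_carrier [simp]: "real_diag n d \<in> carrier_mat n n"
  by (simp add: real_diag_def)

lemma real_diag_dim [simp]: "dim_row (real_diag n d) = n" "dim_col (real_diag n d) = n"
  by (simp_all add: real_diag_def mat_diag_def)

lemma assoc_sandwich:
  fixes A :: "'a :: semiring_0 mat"
  assumes "A \<in> carrier_mat n n" "B \<in> carrier_mat n n" "C \<in> carrier_mat n n"
    "D \<in> carrier_mat n n" "E \<in> carrier_mat n n"
  shows "A * (B * C * D) * E = (A * B) * C * (D * E)"
  using assms by (simp add: assoc_mult_mat[of _ n n _ n _ n])

lemma unitary_matD: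
  assumes "unitary_mat n U"
  shows "U \<in> carrier_mat n n" "mat_adjoint U \<in> carrier_mat n n"
    "mat_adjoint U * U = 1\<^sub>m n" "U * mat_adjoint U = 1\<^sub>m n"
proof -
  show U: "U \<in> carrier_mat n n" and "mat_adjoint U * U = 1\<^sub>m n" "U * mat_adjoint U = 1\<^sub>m n"
    using assms unfolding unitary_mat_def by blast+
  show "mat_adjoint U \<in> carrier_mat n n"
    by (rule carrier_matI) (simp_all only: mat_adjoint_dim carrier_matD[OF U])
qed

lemma diagonalization_unique:
  assumes U: "unitary_mat n U" and V: "unitary_mat n V"
    and eq: "U * real_diag n d * mat_adjoint U = V * real_diag n e * mat_adjoint V"
  shows "U * real_diag n (\<lambda>i. f (d i)) * mat_adjoint U
       = V * real_diag n (\<lambda>i. f (e i)) * mat_adjoint V"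
proof -
  let ?Us = "mat_adjoint U" and ?Vs = "mat_adjoint V"
  note u = unitary_matD[OF U] and v = unitary_matD[OF V]
  define W where "W = ?Vs * U"
  have w: "W \<in> carrier_mat n n"
    unfolding W_def by (rule mult_carrier_mat[OF v(2) u(1)])
  let ?f = "real_diag n (\<lambda>i. f (d i))" and ?g = "real_diag n (\<lambda>i. f (e i))"
  have "W * real_diag n d = ?Vs * U * real_diag n d * (?Us * U)"
    unfolding u(3) W_def[symmetric]
    by (rule right_mult_one_mat[OF mult_carrier_mat[OF w real_diag_carrier], symmetric])
  also have "\<dots> = ?Vs * (V * real_diag n e * ?Vs) * U"
    unfolding eq[symmetric] by (rule assoc_sandwich[symmetric]) (rule u v real_diag_carrier)+
  also have "\<dots> = (?Vs * V) * real_diag n e * (?Vs * U)"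
    by (rule assoc_sandwich) (rule u v real_diag_carrier)+
  also have "\<dots> = real_diag n e * W"
    unfolding v(3) W_def[symmetric]
    by (simp only: left_mult_one_mat[OF real_diag_carrier])
  finally have comm: "W * real_diag n d = real_diag n e * W" .
  have entries: "(W * real_diag n a) $$ (i, j) = W $$ (i, j) * complex_of_real (a j)"
    "(real_diag n a * W) $$ (i, j) = complex_of_real (a i) * W $$ (i, j)"
    if "i < n" "j < n" for a i j
    using that unfolding real_diag_def mat_diag_mult_left[OF w] mat_diag_mult_right[OF w] by simp_all
  have commf: "W * ?f = ?g * W"
  proof (rule eq_matI)
    fix i j assume "i < dim_row (?g * W)" and "j < dim_col (?g * W)"
    then have ij: "i < n" "j < n" using w by simp_all
    have "W $$ (i, j) * complex_of_real (d j) = complex_of_real (e i) * W $$ (i, j)"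
      using arg_cong[OF comm, of "\<lambda>M. M $$ (i, j)"] unfolding entries[OF ij] .
    then have "W $$ (i, j) = 0 \<or> d j = e i" by auto
    then show "(W * ?f) $$ (i, j) = (?g * W) $$ (i, j)"
      unfolding entries[OF ij] by auto
  qed (use w in simp_all)
  have VW: "V * W = U"
    unfolding W_def assoc_mult_mat[OF v(1) v(2) u(1), symmetric] v(4)
    by (rule left_mult_one_mat[OF u(1)])
  have WU: "W * ?Us = ?Vs"
    unfolding W_def assoc_mult_mat[OF v(2) u(1) u(2)] u(4)
    by (rule right_mult_one_mat[OF v(2)])
  have "U * ?f * ?Us = V * (W * ?f) * ?Us"
    using assoc_mult_mat[OF v(1) w real_diag_carrier, of "\<lambda>i. f (d i)"] by (simp add: VW)
  also have "\<dots> = V * ?g * (W * ?Us)"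
    unfolding commf assoc_mult_mat[OF v(1) mult_carrier_mat[OF real_diag_carrier w] u(2)]
      assoc_mult_mat[OF real_diag_carrier w u(2)]
      assoc_mult_mat[OF v(1) real_diag_carrier mult_carrier_mat[OF w u(2)]] ..
  finally show ?thesis by (simp only: WU)
qed

lemma mat_fun_eqI:
  assumes U: "unitary_mat n U" and A: "A = U * real_diag n d * mat_adjoint U"
  shows "mat_fun f A = U * real_diag n (\<lambda>i. f (d i)) * mat_adjoint U"
proof -
  have n: "dim_row A = n" using unitary_matD(1)[OF U] by (simp add: A)
  show ?thesis
    unfolding mat_fun_def n
  proof (rule the_equality)
    fix B
    assume "\<exists>V e. unitary_mat n V \<and> A = V * real_diag n e * mat_adjoint V \<and>
      B = V * real_diag n (\<lambda>i. f (e i)) * mat_adjoint V"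
    then obtain V e where V: "unitary_mat n V" "A = V * real_diag n e * mat_adjoint V"
      and B: "B = V * real_diag n (\<lambda>i. f (e i)) * mat_adjoint V" by blast
    show "B = U * real_diag n (\<lambda>i. f (d i)) * mat_adjoint U"
      unfolding B by (rule diagonalization_unique[OF V(1) U]) (simp only: V(2)[symmetric] A[symmetric])
  qed (use U A in blast)
qed

end

theory Submission
  imports Defs
begin

text \<open>
  Let \<open>\<sigma>\<close> be the product of the reduced matrices, and diagonalize \<open>\<rho>\<close> with eigenvectors \<open>u\<^sub>a\<close> and
  eigenvalues \<open>p\<^sub>a\<close>, and \<open>\<sigma>\<close> with product eigenvectors \<open>v\<^sub>b\<close> and eigenvalues \<open>q\<^sub>b\<close>. The weights
  \<open>w\<^sub>a\<^sub>b = |\<langle>u\<^sub>a, v\<^sub>b\<rangle>|\<^sup>2\<close> are doubly stochastic. The numbers \<open>\<langle>v\<^sub>b, \<rho> v\<^sub>b\<rangle> = \<Sum>\<^sub>a w\<^sub>a\<^sub>b p\<^sub>a\<close> form a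
  probability distribution whose marginals are the spectra of the reduced matrices. Hence it vanishes
  where \<open>q\<close> does, and \<open>\<Sum>\<^sub>a\<^sub>b w\<^sub>a\<^sub>b p\<^sub>a ln q\<^sub>b\<close> is minus the sum of the reduced entropies. The
  difference of the entropies is therefore \<open>\<Sum>\<^sub>a\<^sub>b w\<^sub>a\<^sub>b p\<^sub>a ln (q\<^sub>b / p\<^sub>a)\<close>, which by Jensen's
  inequality is at most \<open>2 ln (\<Sum>\<^sub>a\<^sub>b w\<^sub>a\<^sub>b \<surd>(p\<^sub>a q\<^sub>b)) = 2 ln Tr (\<surd>\<rho> \<surd>\<sigma>)\<close>. Finally,
  \<open>Tr (\<surd>\<rho> - \<surd>\<sigma>)\<^sup>2 = 2 - 2 Tr (\<surd>\<rho> \<surd>\<sigma>)\<close>, and this vanishes only if \<open>\<rho> = \<sigma>\<close>.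
\<close>

section \<open>Unitary diagonalization of self-adjoint matrices\<close>

lemma index_mat_adjoint:
  fixes A :: "complex mat"
  assumes "i < dim_col A" "j < dim_row A"
  shows "mat_adjoint A $$ (i, j) = cnj (A $$ (j, i))"
  using assms by (simp add: mat_adjoint_def mat_of_rows_index)

lemma mat_adjoint_carrier [simp]:
  "A \<in> carrier_mat m n \<Longrightarrow> mat_adjoint A \<in> carrier_mat n m"
  by (auto intro!: carrier_matI)

lemma mult_carrier_mat_square [simp]:
  "A \<in> carrier_mat n n \<Longrightarrow> B \<in> carrier_mat n n \<Longrightarrow> A * B \<in> carrier_mat n n"
  by (rule mult_carrier_mat)

lemma mat_adjoint_adjoint [simp]: "mat_adjoint (mat_adjoint A) = (A :: complex mat)"
  by (rule eq_matI) (simp_all add: index_mat_adjoint)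

lemma index_mult_mat_sum:
  assumes "A \<in> carrier_mat n m" "B \<in> carrier_mat m p" "i < n" "j < p"
  shows "(A * B) $$ (i, j) = (\<Sum>k<m. A $$ (i, k) * B $$ (k, j))"
  using assms by (auto simp: scalar_prod_def lessThan_atLeast0 intro!: sum.cong)

lemma mat_adjoint_mult:
  fixes A :: "complex mat"
  assumes "A \<in> carrier_mat n m" "B \<in> carrier_mat m p"
  shows "mat_adjoint (A * B) = mat_adjoint B * mat_adjoint A"
proof (rule eq_matI)
  fix i j assume "i < dim_row (mat_adjoint B * mat_adjoint A)" "j < dim_col (mat_adjoint B * mat_adjoint A)"
  then have ij: "i < p" "j < n" using assms by simp_all
  have "mat_adjoint (A * B) $$ (i, j) = cnj ((A * B) $$ (j, i))"
    using ij assms by (subst index_mat_adjoint) simp_all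
  also have "\<dots> = (mat_adjoint B * mat_adjoint A) $$ (i, j)"
    using ij assms
    by (simp del: index_mult_mat(1) add: index_mult_mat_sum[OF assms] index_mat_adjoint mult.commute
        index_mult_mat_sum[of "mat_adjoint B" p m "mat_adjoint A" n])
  finally show "mat_adjoint (A * B) $$ (i, j) = (mat_adjoint B * mat_adjoint A) $$ (i, j)" .
qed (use assms in simp_all)

lemma index_real_diag:
  "i < n \<Longrightarrow> j < n \<Longrightarrow> real_diag n d $$ (i, j) = (if i = j then complex_of_real (d i) else 0)"
  by (simp add: real_diag_def mat_diag_def)

lemma mat_adjoint_real_diag [simp]: "mat_adjoint (real_diag n d) = real_diag n d"
  by (rule eq_matI) (auto simp: index_mat_adjoint index_real_diag)

lemma index_real_diag_sandwich:
  fixes A :: "complex mat"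
  assumes "A \<in> carrier_mat m n" "B \<in> carrier_mat n p" "i < m" "j < p"
  shows "(A * real_diag n d * B) $$ (i, j) = (\<Sum>k<n. A $$ (i, k) * complex_of_real (d k) * B $$ (k, j))"
proof -
  have "A * real_diag n d = mat m n (\<lambda>(i, j). A $$ (i, j) * complex_of_real (d j))"
    unfolding real_diag_def by (rule mat_diag_mult_right[OF assms(1)])
  then show ?thesis
    using assms by (subst index_mult_mat_sum[of _ m n _ p]) (auto intro!: sum.cong)
qed

text \<open>For square matrices a left inverse is also a right inverse, so one of the two unitarity
  equations suffices.\<close>

lemma unitary_matI:
  assumes U: "U \<in> carrier_mat n n" and "mat_adjoint U * U = 1\<^sub>m n"
  shows "unitary_mat n U"
  using assms mat_mult_left_right_inverse[OF mat_adjoint_carrier[OF U] U]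
  unfolding unitary_mat_def by blast

lemma unitary_mat_mult:
  assumes "unitary_mat n U" "unitary_mat n V"
  shows "unitary_mat n (U * V)"
proof (rule unitary_matI)
  note u = unitary_matD[OF assms(1)] and v = unitary_matD[OF assms(2)]
  show "U * V \<in> carrier_mat n n" using u v by simp
  have "mat_adjoint (U * V) * (U * V) = mat_adjoint V * (mat_adjoint U * (U * V))"
    using u v by (simp add: mat_adjoint_mult[OF u(1) v(1)] assoc_mult_mat[of _ n n _ n _ n])
  also have "mat_adjoint U * (U * V) = V"
    using u v by (simp add: assoc_mult_mat[symmetric, of _ n n _ n _ n])
  finally show "mat_adjoint (U * V) * (U * V) = 1\<^sub>m n" using v by simp
qed

lemma unitary_mat_adjoint:
  assumes "unitary_mat n U"
  shows "unitary_mat n (mat_adjoint U)"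
  using unitary_matD[OF assms] by (auto simp: unitary_mat_def)

text \<open>Complete \<open>v\<close> to a basis with \<open>v\<close> in front, orthogonalize and
  normalize. The scalar \<open>c\<close> comes from the normalization.\<close>

lemma unitary_with_first_column:
  fixes v :: "complex vec"
  assumes v: "v \<in> carrier_vec n" "v \<noteq> 0\<^sub>v n"
  obtains W c where "unitary_mat n W" "col W 0 = c \<cdot>\<^sub>v v"
proof -
  interpret cof_vec_space n "TYPE(complex)" .
  define b where "b = basis_completion v"
  note bc = basis_completion[OF v, folded b_def]
  have n: "n \<noteq> 0" using v by (metis eq_vecI carrier_vecD index_zero_vec(2) less_nat_zero_code)
  obtain vs where bv: "b = v # vs" using bc(6,7) n by (cases b) auto
  define ws where "ws = gram_schmidt n b"
  have orth: "corthogonal ws" and carr: "set ws \<subseteq> carrier_vec n" and len: "length ws = n"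
    using gram_schmidt_result[OF bc(2,4,5) refl] bc(6) by (auto simp: ws_def)
  \<comment> \<open>Gram-Schmidt leaves the first basis vector unchanged.\<close>
  have "hd ws = v" unfolding ws_def bv by (rule gram_schmidt_hd[OF v(1)])
  then have ws0: "ws ! 0 = v" using len n by (metis hd_conv_nth length_0_conv)
  have wsc: "ws ! j \<in> carrier_vec n" if "j < n" for j using carr len that by auto
  define r where "r j = (\<Sum>k<n. (cmod (ws ! j $ k))\<^sup>2)" for j
  have ip: "ws ! i \<bullet>c ws ! j = (\<Sum>k<n. ws ! i $ k * cnj (ws ! j $ k))" if "i < n" "j < n" for i j
    using wsc[OF that(1)] wsc[OF that(2)]
    by (auto simp: scalar_prod_def lessThan_atLeast0 intro!: sum.cong)
  have ipr: "ws ! j \<bullet>c ws ! j = complex_of_real (r j)" if "j < n" for j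
    unfolding ip[OF that that] r_def by (simp add: complex_norm_square del: of_real_power)
  have r0: "r j > 0" if "j < n" for j
  proof -
    have "ws ! j \<bullet>c ws ! j \<noteq> 0" using corthogonalD[OF orth, of j j] that len by simp
    then have "r j \<noteq> 0" using ipr[OF that] by auto
    moreover have "r j \<ge> 0" unfolding r_def by (intro sum_nonneg) simp
    ultimately show ?thesis by simp
  qed
  \<comment> \<open>The vectors \<open>ws\<close> are orthogonal but need not have norm 1. Since
    \<open>r j\<close> is the squared norm of \<open>ws ! j\<close>, each column is divided by
    \<open>sqrt (r j)\<close>.\<close>
  define W where "W = mat n n (\<lambda>(i, j). ws ! j $ i / complex_of_real (sqrt (r j)))"
  have W: "W \<in> carrier_mat n n" by (simp add: W_def)
  have "mat_adjoint W * W = 1\<^sub>m n"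
  proof (rule eq_matI)
    fix i j assume "i < dim_row (1\<^sub>m n :: complex mat)" "j < dim_col (1\<^sub>m n :: complex mat)"
    then have ij: "i < n" "j < n" by simp_all
    have "(mat_adjoint W * W) $$ (i, j) =
        (\<Sum>k<n. cnj (ws ! i $ k / complex_of_real (sqrt (r i))) * (ws ! j $ k / complex_of_real (sqrt (r j))))"
      using ij W by (subst index_mult_mat_sum[of _ n n _ n]) (auto simp: index_mat_adjoint W_def intro!: sum.cong)
    also have "\<dots> = (ws ! j \<bullet>c ws ! i) / (complex_of_real (sqrt (r i)) * complex_of_real (sqrt (r j)))"
      unfolding ip[OF ij(2,1)] sum_divide_distrib by (intro sum.cong) (simp_all add: mult.commute)
    also have "\<dots> = (if i = j then 1 else 0)"
    proof (cases "i = j")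
      case True
      have "complex_of_real (sqrt (r j)) * complex_of_real (sqrt (r j)) = complex_of_real (r j)"
        using r0[OF ij(2)] by (simp flip: of_real_mult)
      then show ?thesis using True r0[OF ij(2)] ipr[OF ij(2)] by simp
    next
      case False
      then show ?thesis using corthogonalD[OF orth, of j i] ij len by simp
    qed
    finally show "(mat_adjoint W * W) $$ (i, j) = 1\<^sub>m n $$ (i, j)" using ij by simp
  qed (use W in simp_all)
  with W have "unitary_mat n W" by (rule unitary_matI)
  moreover have "col W 0 = (1 / complex_of_real (sqrt (r 0))) \<cdot>\<^sub>v v"
    using n v(1) ws0 by (intro eq_vecI) (auto simp: W_def)
  ultimately show ?thesis by (rule that)
qed

text \<open>Induction on the dimension by deflation: in an orthonormal basis that begins with an
  eigenvector, a self-adjoint matrix splits into a real 1 by 1 block and a self-adjoint block of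
  size \<open>n\<close>.\<close>

theorem hermitian_diagonalization:
  fixes A :: "complex mat"
  assumes "A \<in> carrier_mat n n" "mat_adjoint A = A"
  obtains U d where "unitary_mat n U" "A = U * real_diag n d * mat_adjoint U"
  using assms
proof (induction n arbitrary: A thesis)
  case 0
  have "unitary_mat 0 (1\<^sub>m 0)" by (rule unitary_matI) (auto intro!: eq_matI)
  moreover have "A = 1\<^sub>m 0 * real_diag 0 d * mat_adjoint (1\<^sub>m 0)" for d
    using "0.prems"(2) by (auto intro!: eq_matI)
  ultimately show ?case using "0.prems"(1) by blast
next
  case (Suc n)
  let ?N = "Suc n"
  note A = Suc.prems(2)
  \<comment> \<open>Over the complex numbers the characteristic polynomial splits into
    \<open>Suc n\<close> linear factors, so at least one root \<open>e\<close> exists.\<close>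
  obtain as where cp: "char_poly A = (\<Prod>a\<leftarrow>as. [:- a, 1:])" and las: "length as = ?N"
    using char_poly_factorized[OF A] by blast
  then obtain e as' where "as = e # as'" by (cases as) auto
  then have "eigenvalue A e" by (simp add: eigenvalue_root_char_poly[OF A] cp)
  then obtain v where v: "v \<in> carrier_vec ?N" "v \<noteq> 0\<^sub>v ?N" "A *\<^sub>v v = e \<cdot>\<^sub>v v"
    using A by (auto simp: eigenvalue_def eigenvector_def)
  obtain W c where W: "unitary_mat ?N W" and col0: "col W 0 = c \<cdot>\<^sub>v v"
    using unitary_with_first_column[OF v(1,2)] by blast
  note w = unitary_matD[OF W]
  define B where "B = mat_adjoint W * A * W"
  have B: "B \<in> carrier_mat ?N ?N" using w A by (simp add: B_def)
  have Badj: "mat_adjoint B = B"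
    using w A Suc.prems(3)
    by (simp add: B_def mat_adjoint_mult[of _ ?N ?N _ ?N] assoc_mult_mat[of _ ?N ?N _ ?N _ ?N])
  have Bcnj: "B $$ (i, j) = cnj (B $$ (j, i))" if "i < ?N" "j < ?N" for i j
    using arg_cong[OF Badj, of "\<lambda>M. M $$ (i, j)"] that B by (simp add: index_mat_adjoint)
  have colAW: "col (A * W) 0 = e \<cdot>\<^sub>v col W 0"
  proof -
    have "col (A * W) 0 = A *\<^sub>v col W 0" using A w by (intro eq_vecI) auto
    also have "\<dots> = e \<cdot>\<^sub>v col W 0"
      unfolding col0 using v A by (simp add: mult_mat_vec smult_smult_assoc mult.commute)
    finally show ?thesis .
  qed
  \<comment> \<open>Since \<open>A * W\<close> has first column \<open>e\<close> times that of
    \<open>W\<close>, the first column of \<open>B\<close> is \<open>e\<close> times that of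
    \<open>mat_adjoint W * W\<close>, the identity.\<close>
  have B0: "B $$ (i, 0) = (if i = 0 then e else 0)" if "i < ?N" for i
  proof -
    have "B $$ (i, 0) = row (mat_adjoint W) i \<bullet> col (A * W) 0"
      using w A that by (simp add: B_def assoc_mult_mat[of _ ?N ?N _ ?N _ ?N])
    also have "\<dots> = e * (mat_adjoint W * W) $$ (i, 0)"
      unfolding colAW using w(1) that by simp
    also have "\<dots> = (if i = 0 then e else 0)" unfolding w(3) using that by simp
    finally show ?thesis .
  qed
  have e: "e = complex_of_real (Re e)"
    using Bcnj[of 0 0] B0[of 0] by (simp add: complex_eq_iff)
  \<comment> \<open>Self-adjointness makes \<open>e\<close> real and carries the zeros of the first
    column over to the first row.\<close>
  have B0': "B $$ (0, j) = (if j = 0 then e else 0)" if "j < ?N" for j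
    using Bcnj[of 0 j] B0[OF that] that e by (simp add: complex_eq_iff)
  define C where "C = mat n n (\<lambda>(i, j). B $$ (Suc i, Suc j))"
  have "C \<in> carrier_mat n n" by (simp add: C_def)
  moreover have "mat_adjoint C = C"
  proof (rule eq_matI)
    fix i j assume "i < dim_row C" "j < dim_col C"
    then have "i < n" "j < n" by (simp_all add: C_def)
    then show "mat_adjoint C $$ (i, j) = C $$ (i, j)"
      using Bcnj[of "Suc i" "Suc j"] by (simp add: C_def index_mat_adjoint)
  qed (simp_all add: C_def)
  ultimately obtain V d where V: "unitary_mat n V" and CV: "C = V * real_diag n d * mat_adjoint V"
    using Suc.IH by blast
  note vv = unitary_matD[OF V]
  \<comment> \<open>\<open>X\<close> is the block sum of 1 and \<open>V\<close>, and
    \<open>D\<close> puts \<open>Re e\<close> in front of \<open>d\<close>. The truncated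
    \<open>i - 1\<close> is read only for nonzero \<open>i\<close>.\<close>
  define X where "X = mat ?N ?N (\<lambda>(i, j). if i = 0 \<or> j = 0 then (if i = j then 1 else 0) else V $$ (i - 1, j - 1))"
  define D where "D = (\<lambda>i. if i = 0 then Re e else d (i - 1))"
  have X: "X \<in> carrier_mat ?N ?N" by (simp add: X_def)
  have "unitary_mat ?N X"
  proof (rule unitary_matI[OF X], rule eq_matI)
    fix i j assume "i < dim_row (1\<^sub>m ?N :: complex mat)" "j < dim_col (1\<^sub>m ?N :: complex mat)"
    then have ij: "i < ?N" "j < ?N" by simp_all
    have "(mat_adjoint V * V) $$ (i - 1, j - 1) = (\<Sum>k<n. cnj (V $$ (k, i - 1)) * V $$ (k, j - 1))"
      if "i \<noteq> 0" "j \<noteq> 0"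
      using that ij vv by (subst index_mult_mat_sum[of _ n n _ n]) (auto simp: index_mat_adjoint intro!: sum.cong)
    then show "(mat_adjoint X * X) $$ (i, j) = 1\<^sub>m ?N $$ (i, j)"
      using ij X vv(3)
      by (subst index_mult_mat_sum[of _ ?N ?N _ ?N]; cases i; cases j)
        (auto simp: index_mat_adjoint X_def sum.lessThan_Suc_shift simp del: sum.lessThan_Suc)
  qed (use X in simp_all)
  note XU = this and xx = unitary_matD[OF this]
  have "B = X * real_diag ?N D * mat_adjoint X"
  proof (rule eq_matI)
    fix i j assume "i < dim_row (X * real_diag ?N D * mat_adjoint X)" "j < dim_col (X * real_diag ?N D * mat_adjoint X)"
    then have ij: "i < ?N" "j < ?N" using X by simp_all
    have "C $$ (i - 1, j - 1) = (\<Sum>k<n. V $$ (i - 1, k) * complex_of_real (d k) * cnj (V $$ (j - 1, k)))"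
      if "i \<noteq> 0" "j \<noteq> 0"
      using that ij vv unfolding CV
      by (subst index_real_diag_sandwich[of _ n n _ n]) (auto simp: index_mat_adjoint intro!: sum.cong)
    moreover have "C $$ (i - 1, j - 1) = B $$ (i, j)" if "i \<noteq> 0" "j \<noteq> 0"
      using that ij by (simp add: C_def)
    ultimately show "B $$ (i, j) = (X * real_diag ?N D * mat_adjoint X) $$ (i, j)"
      using ij X B0 B0' e
      by (subst index_real_diag_sandwich[of _ ?N ?N _ ?N]; cases i; cases j)
        (auto simp: index_mat_adjoint X_def D_def sum.lessThan_Suc_shift simp del: sum.lessThan_Suc)
  qed (use B X in simp_all)
  note BX = this
  have "A = W * B * mat_adjoint W"
  proof -
    have "W * B * mat_adjoint W = (W * mat_adjoint W) * A * (W * mat_adjoint W)"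
      using w(1) A by (simp add: B_def assoc_mult_mat[of _ ?N ?N _ ?N _ ?N])
    then show ?thesis using A unfolding w(4) by simp
  qed
  also have "\<dots> = (W * X) * real_diag ?N D * mat_adjoint (W * X)"
    unfolding BX using w xx
    by (simp add: mat_adjoint_mult[of _ ?N ?N _ ?N] assoc_mult_mat[of _ ?N ?N _ ?N _ ?N])
  finally show ?case
    using Suc.prems(1) unitary_mat_mult[OF W XU] by blast
qed

section \<open>Traces, quadratic forms and entropies of diagonalized matrices\<close>

lemma mat_trace_mult_comm:
  assumes "A \<in> carrier_mat n m" "B \<in> carrier_mat m n"
  shows "mat_trace (A * B) = mat_trace (B * A)"
proof -
  have "mat_trace (A * B) = (\<Sum>i<n. \<Sum>k<m. A $$ (i, k) * B $$ (k, i))"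
    using assms unfolding mat_trace_def
    by (auto simp: index_mult_mat_sum[OF assms] simp del: index_mult_mat(1) intro!: sum.cong)
  also have "\<dots> = (\<Sum>k<m. \<Sum>i<n. B $$ (k, i) * A $$ (i, k))"
    by (subst sum.swap) (simp add: mult.commute)
  also have "\<dots> = mat_trace (B * A)"
    using assms unfolding mat_trace_def
    by (auto simp: index_mult_mat_sum[OF assms(2,1)] simp del: index_mult_mat(1) intro!: sum.cong)
  finally show ?thesis .
qed

lemma mat_trace_diff:
  "A \<in> carrier_mat n n \<Longrightarrow> B \<in> carrier_mat n n \<Longrightarrow> mat_trace (A - B) = mat_trace A - mat_trace B"
  by (auto simp: mat_trace_def sum_subtractf)

lemma mat_trace_diagonalized:
  assumes "unitary_mat n U"
  shows "mat_trace (U * real_diag n d * mat_adjoint U) = complex_of_real (\<Sum>i<n. d i)"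
proof -
  note u = unitary_matD[OF assms]
  have "mat_trace (U * real_diag n d * mat_adjoint U) = mat_trace (mat_adjoint U * (U * real_diag n d))"
    using u by (intro mat_trace_mult_comm[of _ n n]) auto
  also have "mat_adjoint U * (U * real_diag n d) = real_diag n d"
    using u by (simp add: assoc_mult_mat[symmetric, of _ n n _ n _ n])
  finally show ?thesis by (simp add: mat_trace_def index_real_diag)
qed

lemma vn_entropy_diagonalized:
  assumes "unitary_mat n U" "A = U * real_diag n d * mat_adjoint U"
  shows "vn_entropy A = - (\<Sum>i<n. d i * ln (d i))"
  unfolding vn_entropy_def mat_fun_eqI[OF assms] mat_trace_diagonalized[OF assms(1)] by simp

text \<open>This is the inner product of \<open>x\<close> with \<open>A x\<close>. Vectors are
  functions on indices, so that a product vector is just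
  \<open>\<lambda>i. x (i div n) * y (i mod n)\<close>; only values below \<open>n\<close>
  matter.\<close>

definition quadratic_form :: "nat \<Rightarrow> complex mat \<Rightarrow> (nat \<Rightarrow> complex) \<Rightarrow> complex" where
  "quadratic_form n A x = (\<Sum>i<n. \<Sum>j<n. cnj (x i) * A $$ (i, j) * x j)"

lemma quadratic_form_vec:
  assumes "A \<in> carrier_mat n n" "v \<in> carrier_vec n"
  shows "(A *\<^sub>v v) \<bullet>c v = quadratic_form n A (\<lambda>i. v $ i)"
proof -
  have "(A *\<^sub>v v) \<bullet>c v = (\<Sum>i<n. (\<Sum>j<n. A $$ (i, j) * v $ j) * cnj (v $ i))"
    using assms by (auto simp: scalar_prod_def lessThan_atLeast0 intro!: sum.cong)
  then show ?thesis
    by (simp add: quadratic_form_def sum_distrib_right sum_distrib_left mult_ac)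
qed

lemma positive_semidefinite_iff:
  "positive_semidefinite n A \<longleftrightarrow>
     A \<in> carrier_mat n n \<and> mat_adjoint A = A \<and> (\<forall>x. 0 \<le> Re (quadratic_form n A x))"
proof -
  have "Re (quadratic_form n A x) = Re ((A *\<^sub>v vec n x) \<bullet>c vec n x)" if "A \<in> carrier_mat n n" for x
    by (subst quadratic_form_vec[OF that]) (auto simp: quadratic_form_def intro!: sum.cong)
  then show ?thesis
    unfolding positive_semidefinite_def
    by (metis quadratic_form_vec vec_carrier)
qed

text \<open>For a fixed \<open>a\<close>, the double sum over \<open>i\<close> and \<open>j\<close>
  factors as \<open>cnj z * z\<close>, where \<open>z\<close> is the inner product of
  \<open>x\<close> with the eigenvector in column \<open>a\<close>.\<close>

lemma quadratic_form_diagonalized: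
  assumes U: "U \<in> carrier_mat n n"
  shows "quadratic_form n (U * real_diag n d * mat_adjoint U) x
       = complex_of_real (\<Sum>a<n. d a * (cmod (\<Sum>i<n. cnj (U $$ (i, a)) * x i))\<^sup>2)"
proof -
  have "quadratic_form n (U * real_diag n d * mat_adjoint U) x =
      (\<Sum>i<n. \<Sum>j<n. \<Sum>a<n. complex_of_real (d a) * ((cnj (x i) * U $$ (i, a)) * (cnj (U $$ (j, a)) * x j)))"
    unfolding quadratic_form_def
  proof (intro sum.cong refl)
    fix i j assume "i \<in> {..<n}" "j \<in> {..<n}"
    then have "(U * real_diag n d * mat_adjoint U) $$ (i, j) = (\<Sum>a<n. U $$ (i, a) * complex_of_real (d a) * cnj (U $$ (j, a)))"
      using U by (subst index_real_diag_sandwich[of _ n n _ n]) (auto simp: index_mat_adjoint intro!: sum.cong)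
    then show "cnj (x i) * (U * real_diag n d * mat_adjoint U) $$ (i, j) * x j =
      (\<Sum>a<n. complex_of_real (d a) * ((cnj (x i) * U $$ (i, a)) * (cnj (U $$ (j, a)) * x j)))"
      by (simp add: sum_distrib_left sum_distrib_right mult_ac)
  qed
  also have "\<dots> = (\<Sum>a<n. \<Sum>i<n. \<Sum>j<n. complex_of_real (d a) * ((cnj (x i) * U $$ (i, a)) * (cnj (U $$ (j, a)) * x j)))"
    by (subst sum.swap, subst (2) sum.swap) (rule refl)
  also have "\<dots> = (\<Sum>a<n. complex_of_real (d a) * (cnj (\<Sum>i<n. cnj (U $$ (i, a)) * x i) * (\<Sum>j<n. cnj (U $$ (j, a)) * x j)))"
    by (simp add: sum_product sum_distrib_left mult_ac)
  also have "\<dots> = complex_of_real (\<Sum>a<n. d a * (cmod (\<Sum>i<n. cnj (U $$ (i, a)) * x i))\<^sup>2)"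
    by (simp add: complex_norm_square mult.commute del: of_real_power)
  finally show ?thesis .
qed

lemma index_adjoint_mult:
  fixes U :: "complex mat"
  assumes "U \<in> carrier_mat n n" "V \<in> carrier_mat n n" "a < n" "b < n"
  shows "(mat_adjoint U * V) $$ (a, b) = (\<Sum>i<n. cnj (U $$ (i, a)) * V $$ (i, b))"
  using assms by (subst index_mult_mat_sum[of _ n n _ n]) (auto simp: index_mat_adjoint intro!: sum.cong)

text \<open>The sum is a diagonal entry of \<open>mat_adjoint U * U\<close>. With its row version,
  applied to a product \<open>mat_adjoint U * V\<close>, it yields doubly stochastic
  weights.\<close>

lemma unitary_column_weight:
  assumes "unitary_mat n U" "b < n"
  shows "(\<Sum>a<n. (cmod (U $$ (a, b)))\<^sup>2) = 1"
proof -
  note u = unitary_matD[OF assms(1)]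
  have "complex_of_real (\<Sum>a<n. (cmod (U $$ (a, b)))\<^sup>2) = (mat_adjoint U * U) $$ (b, b)"
    using assms(2) by (simp add: index_adjoint_mult[OF u(1,1)] complex_norm_square mult.commute
        del: of_real_power index_mult_mat(1))
  then show ?thesis using assms(2) unfolding u(3) by (simp del: of_real_sum)
qed

lemma unitary_row_weight:
  assumes "unitary_mat n U" "a < n"
  shows "(\<Sum>b<n. (cmod (U $$ (a, b)))\<^sup>2) = 1"
  using unitary_column_weight[OF unitary_mat_adjoint[OF assms(1)] assms(2)]
    unitary_matD(1)[OF assms(1)] assms(2)
  by (simp add: index_mat_adjoint)

text \<open>The inner products of column \<open>a\<close> with all columns are entries of the
  identity, so a single term of the spectral sum survives.\<close>

lemma quadratic_form_eigenvector:
  assumes "unitary_mat n U" "A = U * real_diag n d * mat_adjoint U" "a < n"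
  shows "quadratic_form n A (\<lambda>i. U $$ (i, a)) = complex_of_real (d a)"
proof -
  note u = unitary_matD[OF assms(1)]
  have "d c * (cmod (\<Sum>i<n. cnj (U $$ (i, c)) * U $$ (i, a)))\<^sup>2 = (if c = a then d a else 0)" if "c < n" for c
    using that assms(3) unfolding index_adjoint_mult[OF u(1,1) that assms(3), symmetric] u(3) by simp
  then show ?thesis
    unfolding assms(2) quadratic_form_diagonalized[OF u(1)] using assms(3) by simp
qed

text \<open>The eigenvalues are values of the quadratic form at eigenvectors, hence nonnegative, and
  their sum is the trace.\<close>

lemma density_matrix_diagonalization:
  assumes "density_matrix n \<rho>"
  obtains U p where "unitary_mat n U" "\<rho> = U * real_diag n p * mat_adjoint U"
    "\<forall>a<n. 0 \<le> p a" "(\<Sum>a<n. p a) = 1"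
proof -
  have psd: "positive_semidefinite n \<rho>" and tr: "mat_trace \<rho> = 1"
    using assms by (auto simp: density_matrix_def)
  then obtain U p where U: "unitary_mat n U" and \<rho>: "\<rho> = U * real_diag n p * mat_adjoint U"
    using hermitian_diagonalization by (metis positive_semidefinite_iff)
  have "\<forall>a<n. 0 \<le> p a"
    using psd quadratic_form_eigenvector[OF U \<rho>]
    by (metis Re_complex_of_real positive_semidefinite_iff)
  moreover have "(\<Sum>a<n. p a) = 1"
    using tr unfolding \<rho> mat_trace_diagonalized[OF U] by (simp del: of_real_sum)
  ultimately show ?thesis using that U \<rho> by blast
qed

section \<open>Square roots and the affinity of two matrices\<close>

lemma diagonalized_functions_mult:
  assumes "unitary_mat n U"
  shows "(U * real_diag n f * mat_adjoint U) * (U * real_diag n g * mat_adjoint U)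
       = U * real_diag n (\<lambda>i. f i * g i) * mat_adjoint U"
proof -
  note u = unitary_matD[OF assms]
  have "(U * real_diag n f * mat_adjoint U) * (U * real_diag n g * mat_adjoint U)
      = U * real_diag n f * (mat_adjoint U * U) * (real_diag n g * mat_adjoint U)"
    using u(1) by (simp add: assoc_mult_mat[of _ n n _ n _ n])
  also have "\<dots> = U * (real_diag n f * real_diag n g) * mat_adjoint U"
    unfolding u(3) using u(1) by (simp add: assoc_mult_mat[of _ n n _ n _ n])
  also have "real_diag n f * real_diag n g = real_diag n (\<lambda>i. f i * g i)"
    by (simp add: real_diag_def)
  finally show ?thesis .
qed

text \<open>For density matrices this is \<open>Tr (\<surd>A \<surd>B)\<close>.\<close>

definition affinity :: "complex mat \<Rightarrow> complex mat \<Rightarrow> real" where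
  "affinity A B = 1 - 1 / 2 * Re (mat_trace ((mat_sqrt A - mat_sqrt B) ^\<^sub>m 2))"

text \<open>\<open>A\<close> and \<open>B\<close> need not commute, but the two mixed terms have the
  same trace by cyclicity.\<close>

lemma mat_trace_diff_square:
  assumes "A \<in> carrier_mat n n" "B \<in> carrier_mat n n"
  shows "mat_trace ((A - B) ^\<^sub>m 2) = mat_trace (A * A) + mat_trace (B * B) - 2 * mat_trace (A * B)"
proof -
  have "(A - B) ^\<^sub>m 2 = (A - B) * (A - B)"
    using assms by (simp add: numeral_2_eq_2)
  also have "\<dots> = (A * A - A * B) - (B * A - B * B)"
    unfolding minus_mult_distrib_mat[OF assms minus_carrier_mat[OF assms(2)]]
      mult_minus_distrib_mat[OF assms(1) assms] mult_minus_distrib_mat[OF assms(2) assms] ..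
  finally have eq: "(A - B) ^\<^sub>m 2 = (A * A - A * B) - (B * A - B * B)" .
  have c: "A * A - A * B \<in> carrier_mat n n" "B * A - B * B \<in> carrier_mat n n"
    using assms by (intro minus_carrier_mat mult_carrier_mat_square; simp)+
  show ?thesis
    unfolding eq mat_trace_diff[OF c] using assms
    by (simp add: mat_trace_diff[of _ n] mat_trace_mult_comm[of B n n A])
qed

lemma mat_sqrt_diagonalized:
  assumes U: "unitary_mat n U" and A: "A = U * real_diag n p * mat_adjoint U"
    and p: "\<forall>a<n. 0 \<le> p a"
  shows "mat_sqrt A = U * real_diag n (\<lambda>a. sqrt (p a)) * mat_adjoint U"
    "mat_sqrt A \<in> carrier_mat n n"
    "mat_adjoint (mat_sqrt A) = mat_sqrt A"
    "mat_sqrt A * mat_sqrt A = A"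
proof -
  note u = unitary_matD(1)[OF U]
  show eq: "mat_sqrt A = U * real_diag n (\<lambda>a. sqrt (p a)) * mat_adjoint U"
    unfolding mat_sqrt_def by (rule mat_fun_eqI[OF U A])
  show "mat_sqrt A \<in> carrier_mat n n" unfolding eq using u by simp
  show "mat_adjoint (mat_sqrt A) = mat_sqrt A"
    unfolding eq using u
    by (simp add: mat_adjoint_mult[of _ n n _ n] assoc_mult_mat[of _ n n _ n _ n])
  have "real_diag n (\<lambda>a. sqrt (p a) * sqrt (p a)) = real_diag n p"
    using p by (intro eq_matI) (auto simp: index_real_diag simp flip: of_real_mult)
  then show "mat_sqrt A * mat_sqrt A = A"
    unfolding eq diagonalized_functions_mult[OF U] by (simp add: A)
qed

text \<open>Self-adjointness turns \<open>D ^\<^sub>m 2\<close> into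
  \<open>mat_adjoint D * D\<close>, whose trace is the squared Frobenius norm of
  \<open>D\<close>.\<close>

lemma mat_trace_hermitian_square:
  assumes D: "D \<in> carrier_mat n n" "mat_adjoint D = D"
  shows "Re (mat_trace (D ^\<^sub>m 2)) = (\<Sum>j<n. \<Sum>i<n. (cmod (D $$ (i, j)))\<^sup>2)"
proof -
  have "mat_trace (D ^\<^sub>m 2) = mat_trace (mat_adjoint D * D)"
    using D by (simp add: numeral_2_eq_2)
  also have "\<dots> = complex_of_real (\<Sum>j<n. \<Sum>i<n. (cmod (D $$ (i, j)))\<^sup>2)"
    using D(1) unfolding mat_trace_def
    by (auto simp: index_adjoint_mult[OF D(1,1)] complex_norm_square mult.commute
        simp del: of_real_power index_mult_mat(1) intro!: sum.cong)
  finally show ?thesis by (simp del: of_real_sum)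
qed

lemma mat_adjoint_mat_sqrt_diff:
  assumes U: "unitary_mat n U" "A = U * real_diag n p * mat_adjoint U" "\<forall>a<n. 0 \<le> p a"
    and V: "unitary_mat n V" "B = V * real_diag n q * mat_adjoint V" "\<forall>b<n. 0 \<le> q b"
  shows "mat_adjoint (mat_sqrt A - mat_sqrt B) = mat_sqrt A - mat_sqrt B"
proof (rule eq_matI)
  note a = mat_sqrt_diagonalized[OF U] and b = mat_sqrt_diagonalized[OF V]
  have herm: "M $$ (i, j) = cnj (M $$ (j, i))"
    if "M \<in> carrier_mat n n" "mat_adjoint M = M" "i < n" "j < n" for M i j
    using index_mat_adjoint[of i M j] that by simp
  fix i j assume "i < dim_row (mat_sqrt A - mat_sqrt B)" "j < dim_col (mat_sqrt A - mat_sqrt B)"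
  then have ij: "i < n" "j < n" using b(2) by auto
  then show "mat_adjoint (mat_sqrt A - mat_sqrt B) $$ (i, j) = (mat_sqrt A - mat_sqrt B) $$ (i, j)"
    using a(2) b(2) herm[OF a(2,3) ij] herm[OF b(2,3) ij] by (simp add: index_mat_adjoint)
qed (use mat_sqrt_diagonalized(2)[OF V] in simp_all)

text \<open>The defect \<open>1 - affinity A B\<close> is half the squared Frobenius norm of the
  difference of the square roots. If it vanishes, the roots agree, and squaring them gives
  \<open>A = B\<close>.\<close>

lemma affinity_extremal:
  assumes U: "unitary_mat n U" "A = U * real_diag n p * mat_adjoint U" "\<forall>a<n. 0 \<le> p a"
    and V: "unitary_mat n V" "B = V * real_diag n q * mat_adjoint V" "\<forall>b<n. 0 \<le> q b"
  shows "affinity A B \<le> 1" "affinity A B = 1 \<Longrightarrow> A = B"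
proof -
  note a = mat_sqrt_diagonalized[OF U] and b = mat_sqrt_diagonalized[OF V]
  define D where "D = mat_sqrt A - mat_sqrt B"
  have D: "D \<in> carrier_mat n n" unfolding D_def by (rule minus_carrier_mat[OF b(2)])
  have f: "affinity A B = 1 - 1 / 2 * (\<Sum>j<n. \<Sum>i<n. (cmod (D $$ (i, j)))\<^sup>2)"
    unfolding affinity_def D_def[symmetric] using mat_trace_hermitian_square[OF D]
      mat_adjoint_mat_sqrt_diff[OF U V] by (simp add: D_def)
  then show "affinity A B \<le> 1" by (simp add: sum_nonneg)
  assume "affinity A B = 1"
  then have "\<forall>j<n. \<forall>i<n. D $$ (i, j) = 0"
    using f by (simp add: sum_nonneg_eq_0_iff sum_nonneg)
  moreover have "D $$ (i, j) = mat_sqrt A $$ (i, j) - mat_sqrt B $$ (i, j)" if "i < n" "j < n" for i j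
    using a(2) b(2) that by (simp add: D_def)
  ultimately have "mat_sqrt A = mat_sqrt B"
    using a(2) b(2) by (intro eq_matI) auto
  then show "A = B" using a(4) b(4) by metis
qed

text \<open>Unit traces reduce the affinity to the trace of \<open>mat_sqrt A * mat_sqrt B\<close>.
  In the two eigenbases this trace depends only on the eigenvalues and on the overlap matrix
  \<open>W\<close>.\<close>

lemma affinity_diagonalized:
  assumes U: "unitary_mat n U" "A = U * real_diag n p * mat_adjoint U" "\<forall>a<n. 0 \<le> p a"
    and V: "unitary_mat n V" "B = V * real_diag n q * mat_adjoint V" "\<forall>b<n. 0 \<le> q b"
    and p1: "(\<Sum>a<n. p a) = 1" and q1: "(\<Sum>b<n. q b) = 1"
  shows "affinity A B = (\<Sum>a<n. \<Sum>b<n. sqrt (p a) * sqrt (q b) * (cmod ((mat_adjoint U * V) $$ (a, b)))\<^sup>2)"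
proof -
  note a = mat_sqrt_diagonalized[OF U] and b = mat_sqrt_diagonalized[OF V]
  note u = unitary_matD[OF U(1)] and v = unitary_matD[OF V(1)]
  define W where "W = mat_adjoint U * V"
  have W: "W \<in> carrier_mat n n" using u v by (simp add: W_def)
  let ?P = "real_diag n (\<lambda>a. sqrt (p a))" and ?Q = "real_diag n (\<lambda>b. sqrt (q b))"
  have "mat_trace A = 1" "mat_trace B = 1"
    unfolding U(2) V(2) mat_trace_diagonalized[OF U(1)] mat_trace_diagonalized[OF V(1)]
    using p1 q1 by simp_all
  then have "mat_trace ((mat_sqrt A - mat_sqrt B) ^\<^sub>m 2) = 2 - 2 * mat_trace (mat_sqrt A * mat_sqrt B)"
    using mat_trace_diff_square[OF a(2) b(2)] a(4) b(4) by simp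
  then have "affinity A B = Re (mat_trace (mat_sqrt A * mat_sqrt B))"
    by (simp add: affinity_def diff_divide_distrib)
  also have "mat_trace (mat_sqrt A * mat_sqrt B) = mat_trace (U * (?P * W * ?Q * mat_adjoint V))"
    unfolding a(1) b(1) W_def using u(1) v(1) by (simp add: assoc_mult_mat[of _ n n _ n _ n])
  \<comment> \<open>Cyclicity brings \<open>U\<close> next to \<open>mat_adjoint V\<close>, and the
    two combine to \<open>mat_adjoint W\<close>.\<close>
  also have "\<dots> = mat_trace ((?P * W * ?Q * mat_adjoint V) * U)"
    using u v W by (intro mat_trace_mult_comm[of _ n n]) auto
  also have "(?P * W * ?Q * mat_adjoint V) * U = ?P * W * ?Q * mat_adjoint W"
    unfolding W_def using u(1) v(1)
    by (simp add: mat_adjoint_mult[of _ n n _ n] assoc_mult_mat[of _ n n _ n _ n])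
  also have "\<dots> = ?P * (W * ?Q * mat_adjoint W)"
    using W by (simp add: assoc_mult_mat[of _ n n _ n _ n])
  also have "mat_trace \<dots> = (\<Sum>a<n. complex_of_real (sqrt (p a)) * (W * ?Q * mat_adjoint W) $$ (a, a))"
    unfolding mat_trace_def
  proof (intro sum.cong)
    have c: "W * ?Q * mat_adjoint W \<in> carrier_mat n n" using W by simp
    show "(?P * (W * ?Q * mat_adjoint W)) $$ (a, a) = complex_of_real (sqrt (p a)) * (W * ?Q * mat_adjoint W) $$ (a, a)"
      if "a \<in> {..<n}" for a
      using that unfolding real_diag_def[of n "\<lambda>a. sqrt (p a)"] mat_diag_mult_left[OF c] by simp
  qed simp
  also have "\<dots> = complex_of_real (\<Sum>a<n. \<Sum>b<n. sqrt (p a) * sqrt (q b) * (cmod (W $$ (a, b)))\<^sup>2)"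
    unfolding of_real_sum
  proof (intro sum.cong refl)
    fix a assume "a \<in> {..<n}"
    then have "(W * ?Q * mat_adjoint W) $$ (a, a) = (\<Sum>b<n. W $$ (a, b) * complex_of_real (sqrt (q b)) * cnj (W $$ (a, b)))"
      using W by (subst index_real_diag_sandwich[of _ n n _ n]) (auto simp: index_mat_adjoint intro!: sum.cong)
    then show "complex_of_real (sqrt (p a)) * (W * ?Q * mat_adjoint W) $$ (a, a)
      = (\<Sum>b<n. complex_of_real (sqrt (p a) * sqrt (q b) * (cmod (W $$ (a, b)))\<^sup>2))"
      by (simp add: complex_norm_square sum_distrib_left mult_ac del: of_real_power)
  qed
  finally show ?thesis by (simp add: W_def del: of_real_sum)
qed

text \<open>
  Jensen's inequality for the logarithm and the probability weights \<open>w a b * p a\<close>, at the points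
  \<open>sqrt (q b / p a)\<close>. The hypothesis \<open>ac\<close> is absolute continuity.
\<close>

lemma sum_sqrt_weights_ge:
  fixes w :: "nat \<Rightarrow> nat \<Rightarrow> real" and p q :: "nat \<Rightarrow> real"
  assumes w: "\<And>a b. a < n \<Longrightarrow> b < n \<Longrightarrow> 0 \<le> w a b"
    and p: "\<And>a. a < n \<Longrightarrow> 0 \<le> p a" and q: "\<And>b. b < n \<Longrightarrow> 0 \<le> q b"
    and ac: "\<And>a b. a < n \<Longrightarrow> b < n \<Longrightarrow> w a b * p a \<noteq> 0 \<Longrightarrow> 0 < q b"
    and w1: "\<And>a. a < n \<Longrightarrow> (\<Sum>b<n. w a b) = 1"
    and w2: "\<And>b. b < n \<Longrightarrow> (\<Sum>a<n. w a b) = 1"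
    and p1: "(\<Sum>a<n. p a) = 1"
  defines "F \<equiv> (\<Sum>a<n. \<Sum>b<n. sqrt (p a) * sqrt (q b) * w a b)"
  shows "0 < F"
    "(\<Sum>a<n. \<Sum>b<n. w a b * p a * ln (q b)) - (\<Sum>a<n. p a * ln (p a)) \<le> 2 * ln F"
proof -
  have P1: "(\<Sum>a<n. \<Sum>b<n. w a b * p a) = 1"
    using w1 p1 by (simp flip: sum_distrib_right)
  have F0: "0 \<le> sqrt (p a) * sqrt (q b) * w a b" if "a < n" "b < n" for a b
    using that w p q by simp
  \<comment> \<open>The weights \<open>w a b * p a\<close> have sum 1, so one of them is nonzero;
    its term in \<open>F\<close> is then strictly positive by \<open>ac\<close>.\<close>
  obtain a b where ab: "a < n" "b < n" "w a b * p a \<noteq> 0"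
    using P1 by (metis (no_types, lifting) lessThan_iff sum.neutral zero_neq_one)
  have "0 < w a b" "0 < p a"
    using ab w[of a b] p[of a] by (auto simp: less_le)
  then have "0 < sqrt (p a) * sqrt (q b) * w a b" using ac[OF ab] by simp
  also have "\<dots> \<le> (\<Sum>b<n. sqrt (p a) * sqrt (q b) * w a b)"
    using ab F0 by (intro member_le_sum) auto
  also have "\<dots> \<le> F"
    unfolding F_def using ab F0
    by (intro member_le_sum[of a _ "\<lambda>a. \<Sum>b<n. sqrt (p a) * sqrt (q b) * w a b"]) (auto intro!: sum_nonneg)
  finally show F: "0 < F" .
  \<comment> \<open>Jensen's inequality is obtained from the tangent bound
    \<open>ln x \<le> x - 1\<close> at \<open>x = sqrt (q b / p a) / F\<close>, the points divided
    by their mean \<open>F\<close>.\<close>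
  have pt: "w a b * p a * ln (q b) - w a b * p a * ln (p a) - w a b * p a * (2 * ln F)
      \<le> 2 * (sqrt (p a) * sqrt (q b) * w a b / F - w a b * p a)" if ab: "a < n" "b < n" for a b
  proof (cases "w a b * p a = 0")
    \<comment> \<open>Both sides vanish, since \<open>w a b\<close> or \<open>sqrt (p a)\<close> is
      zero; no value of \<open>ln 0\<close> has any influence.\<close>
    case True
    then show ?thesis by auto
  next
    case False
    then have pos: "0 < w a b" "0 < p a" "0 < q b"
      using ab w[of a b] p[of a] ac[OF ab] by (auto simp: less_le)
    have "ln (q b) - ln (p a) - 2 * ln F = 2 * ln (sqrt (q b) / (sqrt (p a) * F))"
      using pos F by (simp add: ln_div ln_mult ln_sqrt)
    also have "\<dots> \<le> 2 * (sqrt (q b) / (sqrt (p a) * F) - 1)"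
      using pos F ln_le_minus_one[of "sqrt (q b) / (sqrt (p a) * F)"] by simp
    finally have "w a b * p a * (ln (q b) - ln (p a) - 2 * ln F)
        \<le> w a b * p a * (2 * (sqrt (q b) / (sqrt (p a) * F) - 1))"
      using pos by (intro mult_left_mono) auto
    also have "\<dots> = 2 * (sqrt (p a) * sqrt (q b) * w a b / F - w a b * p a)"
    proof -
      define s where "s = sqrt (p a)"
      have "p a = s * s" "s \<noteq> 0" using pos by (simp_all add: s_def)
      then show ?thesis using F unfolding s_def[symmetric] by (simp add: field_simps)
    qed
    finally show ?thesis by (simp add: algebra_simps)
  qed
  have "(\<Sum>a<n. \<Sum>b<n. w a b * p a * ln (q b) - w a b * p a * ln (p a) - w a b * p a * (2 * ln F))
      \<le> (\<Sum>a<n. \<Sum>b<n. 2 * (sqrt (p a) * sqrt (q b) * w a b / F - w a b * p a))"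
    using pt by (intro sum_mono) auto
  \<comment> \<open>The first terms add up to \<open>F / F\<close> and the weights to 1, so the
    linear bounds cancel after summation.\<close>
  also have "\<dots> = 2 * (F / F - 1)"
    unfolding F_def by (simp add: sum_subtractf P1 flip: sum_distrib_left sum_divide_distrib)
  also have "\<dots> = 0" using F by simp
  also have "(\<Sum>a<n. \<Sum>b<n. w a b * p a * ln (q b) - w a b * p a * ln (p a) - w a b * p a * (2 * ln F))
      = (\<Sum>a<n. \<Sum>b<n. w a b * p a * ln (q b)) - (\<Sum>a<n. p a * ln (p a)) - 2 * ln F"
    using w1 P1 by (simp add: sum_subtractf flip: sum_distrib_right)
  finally show "(\<Sum>a<n. \<Sum>b<n. w a b * p a * ln (q b)) - (\<Sum>a<n. p a * ln (p a)) \<le> 2 * ln F"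
    by simp
qed

section \<open>Tensor products and partial traces\<close>

text \<open>The blocks of length \<open>n\<close> correspond to the numbering
  \<open>a * n + k\<close> of the tensor basis.\<close>

lemma sum_lessThan_mult:
  fixes f :: "nat \<Rightarrow> 'a :: comm_monoid_add"
  shows "(\<Sum>i<m * n. f i) = (\<Sum>a<m. \<Sum>k<n. f (a * n + k))"
proof -
  have "(\<Sum>i<m * n. f i) = (\<Sum>a<m. sum f {a * n..<a * n + n})"
    by (rule sum.nat_group[symmetric])
  also have "\<dots> = (\<Sum>a<m. \<Sum>k<n. f (a * n + k))"
    by (rule sum.cong[OF refl], subst sum.atLeastLessThan_shift_0) (simp add: lessThan_atLeast0)
  finally show ?thesis .
qed

lemma mult_add_less:
  fixes a k m n :: nat
  assumes "a < m" "k < n"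
  shows "a * n + k < m * n"
proof -
  have "a * n + k < Suc a * n" using assms(2) by simp
  also have "\<dots> \<le> m * n" using assms(1) by (intro mult_right_mono) auto
  finally show ?thesis .
qed

lemma div_mod_less:
  fixes i m n :: nat
  assumes "i < m * n"
  shows "i div n < m" "i mod n < n"
  using assms by (auto simp: less_mult_imp_div_less intro!: mod_less_divisor gr_zeroI)

lemma kron_carrier [simp]:
  "A \<in> carrier_mat m p \<Longrightarrow> B \<in> carrier_mat n q \<Longrightarrow> A \<otimes>\<^sub>m B \<in> carrier_mat (m * n) (p * q)"
  by (auto simp: kron_def)

lemma index_kron:
  assumes "A \<in> carrier_mat m p" "B \<in> carrier_mat n q" "i < m * n" "j < p * q"
  shows "(A \<otimes>\<^sub>m B) $$ (i, j) = A $$ (i div n, j div q) * B $$ (i mod n, j mod q)"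
  using assms by (auto simp: kron_def)

text \<open>The inner summation index splits as \<open>a * q + k\<close>, and the double sum factors
  into the entries of the two products.\<close>

lemma kron_mult:
  assumes A: "A \<in> carrier_mat m p" and B: "B \<in> carrier_mat n q"
    and C: "C \<in> carrier_mat p r" and D: "D \<in> carrier_mat q s"
  shows "(A \<otimes>\<^sub>m B) * (C \<otimes>\<^sub>m D) = (A * C) \<otimes>\<^sub>m (B * D)"
proof (rule eq_matI)
  note AB = kron_carrier[OF A B] and CD = kron_carrier[OF C D]
    and R = kron_carrier[OF mult_carrier_mat[OF A C] mult_carrier_mat[OF B D]]
  fix i j assume "i < dim_row ((A * C) \<otimes>\<^sub>m (B * D))" "j < dim_col ((A * C) \<otimes>\<^sub>m (B * D))"
  then have ij: "i < m * n" "j < r * s" using R by auto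
  note b = div_mod_less[OF ij(1)] div_mod_less[OF ij(2)]
  have "((A \<otimes>\<^sub>m B) * (C \<otimes>\<^sub>m D)) $$ (i, j)
      = (\<Sum>a<p. \<Sum>k<q. (A \<otimes>\<^sub>m B) $$ (i, a * q + k) * (C \<otimes>\<^sub>m D) $$ (a * q + k, j))"
    unfolding index_mult_mat_sum[OF AB CD ij] sum_lessThan_mult ..
  also have "\<dots> = (\<Sum>a<p. \<Sum>k<q. (A $$ (i div n, a) * C $$ (a, j div s)) * (B $$ (i mod n, k) * D $$ (k, j mod s)))"
    using ij by (intro sum.cong refl) (simp add: index_kron[OF A B] index_kron[OF C D] mult_add_less)
  also have "\<dots> = (A * C) $$ (i div n, j div s) * (B * D) $$ (i mod n, j mod s)"
    unfolding index_mult_mat_sum[OF A C b(1,3)] index_mult_mat_sum[OF B D b(2,4)] sum_product ..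
  also have "\<dots> = ((A * C) \<otimes>\<^sub>m (B * D)) $$ (i, j)"
    using index_kron[OF mult_carrier_mat[OF A C] mult_carrier_mat[OF B D] ij] by simp
  finally show "((A \<otimes>\<^sub>m B) * (C \<otimes>\<^sub>m D)) $$ (i, j) = ((A * C) \<otimes>\<^sub>m (B * D)) $$ (i, j)" .
qed (use assms in \<open>auto simp: kron_def\<close>)

lemma mat_adjoint_kron: "mat_adjoint (A \<otimes>\<^sub>m B) = mat_adjoint A \<otimes>\<^sub>m mat_adjoint B"
proof (rule eq_matI)
  fix i j assume "i < dim_row (mat_adjoint A \<otimes>\<^sub>m mat_adjoint B)" "j < dim_col (mat_adjoint A \<otimes>\<^sub>m mat_adjoint B)"
  then have ij: "i < dim_col A * dim_col B" "j < dim_row A * dim_row B" by (simp_all add: kron_def)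
  note b = div_mod_less[OF ij(1)] div_mod_less[OF ij(2)]
  show "mat_adjoint (A \<otimes>\<^sub>m B) $$ (i, j) = (mat_adjoint A \<otimes>\<^sub>m mat_adjoint B) $$ (i, j)"
    using ij b by (subst index_mat_adjoint) (simp_all add: kron_def index_mat_adjoint)
qed (simp_all add: kron_def)

lemma kron_one: "1\<^sub>m m \<otimes>\<^sub>m 1\<^sub>m n = 1\<^sub>m (m * n)"
proof (rule eq_matI)
  fix i j assume "i < dim_row (1\<^sub>m (m * n) :: complex mat)" "j < dim_col (1\<^sub>m (m * n) :: complex mat)"
  then have ij: "i < m * n" "j < m * n" by simp_all
  have "i div n = j div n \<and> i mod n = j mod n \<longleftrightarrow> i = j" by (metis div_mult_mod_eq)
  then show "(1\<^sub>m m \<otimes>\<^sub>m 1\<^sub>m n) $$ (i, j) = 1\<^sub>m (m * n) $$ (i, j)"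
    using ij div_mod_less[OF ij(1)] div_mod_less[OF ij(2)] by (auto simp: kron_def)
qed (simp_all add: kron_def)

lemma kron_real_diag:
  "real_diag m p \<otimes>\<^sub>m real_diag n q = real_diag (m * n) (\<lambda>i. p (i div n) * q (i mod n))"
proof (rule eq_matI)
  fix i j assume "i < dim_row (real_diag (m * n) (\<lambda>i. p (i div n) * q (i mod n)))"
    "j < dim_col (real_diag (m * n) (\<lambda>i. p (i div n) * q (i mod n)))"
  then have ij: "i < m * n" "j < m * n" by simp_all
  have "i div n = j div n \<and> i mod n = j mod n \<longleftrightarrow> i = j" by (metis div_mult_mod_eq)
  then show "(real_diag m p \<otimes>\<^sub>m real_diag n q) $$ (i, j) = real_diag (m * n) (\<lambda>i. p (i div n) * q (i mod n)) $$ (i, j)"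
    using ij div_mod_less[OF ij(1)] div_mod_less[OF ij(2)] by (auto simp: kron_def index_real_diag)
qed (simp_all add: kron_def)

lemma unitary_mat_kron:
  assumes "unitary_mat m U" "unitary_mat n V"
  shows "unitary_mat (m * n) (U \<otimes>\<^sub>m V)"
proof (rule unitary_matI)
  note u = unitary_matD[OF assms(1)] and v = unitary_matD[OF assms(2)]
  show "U \<otimes>\<^sub>m V \<in> carrier_mat (m * n) (m * n)" by (rule kron_carrier[OF u(1) v(1)])
  show "mat_adjoint (U \<otimes>\<^sub>m V) * (U \<otimes>\<^sub>m V) = 1\<^sub>m (m * n)"
    unfolding mat_adjoint_kron kron_mult[OF u(2) v(2) u(1) v(1)] u(3) v(3) by (rule kron_one)
qed

lemma kron_diagonalized:
  assumes "U \<in> carrier_mat m m" "V \<in> carrier_mat n n"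
  shows "(U * real_diag m p * mat_adjoint U) \<otimes>\<^sub>m (V * real_diag n q * mat_adjoint V)
       = (U \<otimes>\<^sub>m V) * real_diag (m * n) (\<lambda>i. p (i div n) * q (i mod n)) * mat_adjoint (U \<otimes>\<^sub>m V)"
  using assms
  by (simp add: kron_mult[of _ m m _ n n _ m _ n] mat_adjoint_kron flip: kron_real_diag)

section \<open>Partial traces and product vectors\<close>

lemma quadratic_form_product:
  assumes \<rho>: "\<rho> \<in> carrier_mat (m * n) (m * n)"
  shows "quadratic_form (m * n) \<rho> (\<lambda>i. x (i div n) * y (i mod n))
    = (\<Sum>i<m. \<Sum>k<n. \<Sum>j<m. \<Sum>l<n. cnj (x i) * x j * (cnj (y k) * y l) * \<rho> $$ (i * n + k, j * n + l))"
  unfolding quadratic_form_def sum_lessThan_mult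
  by (intro sum.cong refl) (simp add: mult_ac)

text \<open>
  A partial trace may be computed in any orthonormal basis of the space traced out. The columns of
  \<open>y\<close> are such a basis.
\<close>

lemma quadratic_form_reduced_fst:
  assumes \<rho>: "\<rho> \<in> carrier_mat (m * n) (m * n)"
    and y: "\<And>k l. k < n \<Longrightarrow> l < n \<Longrightarrow> (\<Sum>b<r. cnj (y k b) * y l b) = (if k = l then 1 else 0)"
  shows "(\<Sum>b<r. quadratic_form (m * n) \<rho> (\<lambda>i. x (i div n) * y (i mod n) b))
    = quadratic_form m (reduced_fst m n \<rho>) x"
proof -
  have "(\<Sum>b<r. quadratic_form (m * n) \<rho> (\<lambda>i. x (i div n) * y (i mod n) b))
    = (\<Sum>b<r. \<Sum>i<m. \<Sum>k<n. \<Sum>j<m. \<Sum>l<n. cnj (x i) * x j * (cnj (y k b) * y l b) * \<rho> $$ (i * n + k, j * n + l))"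
    unfolding quadratic_form_product[OF \<rho>, of x "\<lambda>k. y k _"] ..
  \<comment> \<open>With the sum over \<open>b\<close> innermost, the hypothesis \<open>y\<close>
    turns it into a Kronecker delta in \<open>k\<close> and \<open>l\<close>.\<close>
  also have "\<dots> = (\<Sum>i<m. \<Sum>k<n. \<Sum>j<m. \<Sum>l<n. \<Sum>b<r. cnj (x i) * x j * (cnj (y k b) * y l b) * \<rho> $$ (i * n + k, j * n + l))"
    by (simp only: sum.swap[of _ _ "{..<r}"])
  also have "\<dots> = (\<Sum>i<m. \<Sum>k<n. \<Sum>j<m. \<Sum>l<n. if k = l then cnj (x i) * x j * \<rho> $$ (i * n + k, j * n + l) else 0)"
    by (intro sum.cong refl) (simp add: y flip: sum_distrib_left sum_distrib_right)
  also have "\<dots> = (\<Sum>i<m. \<Sum>k<n. \<Sum>j<m. cnj (x i) * x j * \<rho> $$ (i * n + k, j * n + k))"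
    by (intro sum.cong refl) simp
  also have "\<dots> = (\<Sum>i<m. \<Sum>j<m. \<Sum>k<n. cnj (x i) * x j * \<rho> $$ (i * n + k, j * n + k))"
    by (rule sum.cong[OF refl], rule sum.swap)
  also have "\<dots> = quadratic_form m (reduced_fst m n \<rho>) x"
    unfolding quadratic_form_def
    by (intro sum.cong refl) (simp add: reduced_fst_def sum_distrib_left sum_distrib_right mult_ac)
  finally show ?thesis .
qed

text \<open>Mirror image of the preceding lemma: the columns of \<open>x\<close> are now the
  orthonormal basis of the first factor.\<close>

lemma quadratic_form_reduced_snd:
  assumes \<rho>: "\<rho> \<in> carrier_mat (m * n) (m * n)"
    and x: "\<And>i j. i < m \<Longrightarrow> j < m \<Longrightarrow> (\<Sum>a<r. cnj (x i a) * x j a) = (if i = j then 1 else 0)"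
  shows "(\<Sum>a<r. quadratic_form (m * n) \<rho> (\<lambda>i. x (i div n) a * y (i mod n)))
    = quadratic_form n (reduced_snd m n \<rho>) y"
proof -
  have "(\<Sum>a<r. quadratic_form (m * n) \<rho> (\<lambda>i. x (i div n) a * y (i mod n)))
    = (\<Sum>a<r. \<Sum>i<m. \<Sum>k<n. \<Sum>j<m. \<Sum>l<n. cnj (x i a) * x j a * (cnj (y k) * y l) * \<rho> $$ (i * n + k, j * n + l))"
    unfolding quadratic_form_product[OF \<rho>, of "\<lambda>i. x i _"] ..
  also have "\<dots> = (\<Sum>i<m. \<Sum>k<n. \<Sum>j<m. \<Sum>l<n. \<Sum>a<r. cnj (x i a) * x j a * (cnj (y k) * y l) * \<rho> $$ (i * n + k, j * n + l))"
    by (simp only: sum.swap[of _ _ "{..<r}"])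
  also have "\<dots> = (\<Sum>i<m. \<Sum>k<n. \<Sum>j<m. if i = j then \<Sum>l<n. cnj (y k) * y l * \<rho> $$ (i * n + k, j * n + l) else 0)"
    by (intro sum.cong refl) (simp add: x flip: sum_distrib_left sum_distrib_right)
  also have "\<dots> = (\<Sum>i<m. \<Sum>k<n. \<Sum>l<n. cnj (y k) * y l * \<rho> $$ (i * n + k, i * n + l))"
    by (rule sum.cong[OF refl], rule sum.cong[OF refl]) simp
  also have "\<dots> = (\<Sum>k<n. \<Sum>l<n. \<Sum>i<m. cnj (y k) * y l * \<rho> $$ (i * n + k, i * n + l))"
    by (simp only: sum.swap[of _ _ "{..<m}"])
  also have "\<dots> = quadratic_form n (reduced_snd m n \<rho>) y"
    unfolding quadratic_form_def
    by (intro sum.cong refl) (simp add: reduced_snd_def sum_distrib_left sum_distrib_right mult_ac)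
  finally show ?thesis .
qed

text \<open>This is \<open>U * mat_adjoint U = 1\<^sub>m n\<close> in entries, the completeness
  relation required of the bases in the two preceding lemmas.\<close>

lemma unitary_rows:
  assumes "unitary_mat n U" "k < n" "l < n"
  shows "(\<Sum>b<n. cnj (U $$ (k, b)) * U $$ (l, b)) = (if k = l then 1 else 0)"
proof -
  note u = unitary_matD[OF assms(1)]
  have "(\<Sum>b<n. cnj (U $$ (k, b)) * U $$ (l, b)) = (U * mat_adjoint U) $$ (l, k)"
    using assms(2,3) u(1)
    by (subst index_mult_mat_sum[OF u(1,2)]) (auto simp: index_mat_adjoint mult.commute intro!: sum.cong)
  then show ?thesis using assms(2,3) unfolding u(4) by auto
qed

lemma density_matrix_reduced_fst:
  assumes "density_matrix (m * n) \<rho>"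
  shows "density_matrix m (reduced_fst m n \<rho>)"
proof -
  have c: "\<rho> \<in> carrier_mat (m * n) (m * n)" and h: "mat_adjoint \<rho> = \<rho>"
    and p: "\<And>x. 0 \<le> Re (quadratic_form (m * n) \<rho> x)" and t: "mat_trace \<rho> = 1"
    using assms by (auto simp: density_matrix_def positive_semidefinite_iff)
  have cnj: "cnj (\<rho> $$ (i * n + k, j * n + k)) = \<rho> $$ (j * n + k, i * n + k)" if "i < m" "j < m" "k < n" for i j k
    using index_mat_adjoint[of "j * n + k" \<rho> "i * n + k"] that c h by (simp add: mult_add_less)
  have "mat_adjoint (reduced_fst m n \<rho>) = reduced_fst m n \<rho>"
    by (rule eq_matI) (simp_all add: reduced_fst_def index_mat_adjoint cnj)
  moreover have "0 \<le> Re (quadratic_form m (reduced_fst m n \<rho>) x)" for x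
  proof -
    \<comment> \<open>Tracing out in the standard basis writes the form as a sum of forms of
      \<open>\<rho>\<close>, each of them nonnegative.\<close>
    have "quadratic_form m (reduced_fst m n \<rho>) x =
        (\<Sum>b<n. quadratic_form (m * n) \<rho> (\<lambda>i. x (i div n) * (if i mod n = b then 1 else 0)))"
      by (rule quadratic_form_reduced_fst[OF c, symmetric]) (simp add: if_distrib[of cnj] if_distrib[of "\<lambda>x. x * _"] cong: if_cong)
    then show ?thesis using p by (auto intro: sum_nonneg)
  qed
  moreover have "mat_trace (reduced_fst m n \<rho>) = 1"
    using t c by (simp add: mat_trace_def reduced_fst_def sum_lessThan_mult)
  ultimately show ?thesis
    by (auto simp: density_matrix_def positive_semidefinite_iff reduced_fst_def)
qed

lemma density_matrix_reduced_snd: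
  assumes "density_matrix (m * n) \<rho>"
  shows "density_matrix n (reduced_snd m n \<rho>)"
proof -
  have c: "\<rho> \<in> carrier_mat (m * n) (m * n)" and h: "mat_adjoint \<rho> = \<rho>"
    and p: "\<And>x. 0 \<le> Re (quadratic_form (m * n) \<rho> x)" and t: "mat_trace \<rho> = 1"
    using assms by (auto simp: density_matrix_def positive_semidefinite_iff)
  have cnj: "cnj (\<rho> $$ (i * n + k, i * n + l)) = \<rho> $$ (i * n + l, i * n + k)" if "i < m" "k < n" "l < n" for i k l
    using index_mat_adjoint[of "i * n + l" \<rho> "i * n + k"] that c h by (simp add: mult_add_less)
  have "mat_adjoint (reduced_snd m n \<rho>) = reduced_snd m n \<rho>"
    by (rule eq_matI) (simp_all add: reduced_snd_def index_mat_adjoint cnj)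
  moreover have "0 \<le> Re (quadratic_form n (reduced_snd m n \<rho>) y)" for y
  proof -
    have "quadratic_form n (reduced_snd m n \<rho>) y =
        (\<Sum>a<m. quadratic_form (m * n) \<rho> (\<lambda>i. (if i div n = a then 1 else 0) * y (i mod n)))"
      by (rule quadratic_form_reduced_snd[OF c, symmetric]) (simp add: if_distrib[of cnj] if_distrib[of "\<lambda>x. x * _"] cong: if_cong)
    then show ?thesis using p by (auto intro: sum_nonneg)
  qed
  moreover have "mat_trace (reduced_snd m n \<rho>) = 1"
    using t c by (simp add: mat_trace_def reduced_snd_def sum_lessThan_mult sum.swap[of _ "{..<n}"])
  ultimately show ?thesis
    by (auto simp: density_matrix_def positive_semidefinite_iff reduced_snd_def)
qed

section \<open>Cross entropy\<close>

text \<open>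
  This relation says that \<open>s\<close> is \<open>- Tr (\<rho> ln \<sigma>)\<close>, where the kernel of the density matrix \<open>\<sigma>\<close> is
  contained in that of \<open>\<rho>\<close>. Without the inclusion, the convention \<open>ln 0 = 0\<close> would give a value that
  should be infinite.
\<close>

definition has_cross_entropy :: "nat \<Rightarrow> complex mat \<Rightarrow> complex mat \<Rightarrow> real \<Rightarrow> bool" where
  "has_cross_entropy n \<rho> \<sigma> s \<longleftrightarrow> (\<exists>V q. unitary_mat n V \<and> \<sigma> = V * real_diag n q * mat_adjoint V \<and>
     (\<forall>b<n. 0 \<le> q b) \<and> (\<Sum>b<n. q b) = 1 \<and>
     (\<forall>b<n. Re (quadratic_form n \<rho> (\<lambda>i. V $$ (i, b))) \<noteq> 0 \<longrightarrow> 0 < q b) \<and>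
     (\<Sum>b<n. Re (quadratic_form n \<rho> (\<lambda>i. V $$ (i, b))) * ln (q b)) = - s)"

text \<open>In an eigenbasis of \<open>\<rho>\<close> its diagonal is the spectrum itself, so the
  support condition holds. This supplies the second factor in the bipartite case.\<close>

lemma has_cross_entropy_self:
  assumes "density_matrix n \<rho>"
  shows "has_cross_entropy n \<rho> \<rho> (vn_entropy \<rho>)"
proof -
  obtain U p where U: "unitary_mat n U" "\<rho> = U * real_diag n p * mat_adjoint U"
    and p: "\<forall>a<n. 0 \<le> p a" "(\<Sum>a<n. p a) = 1"
    using density_matrix_diagonalization[OF assms] .
  have R: "Re (quadratic_form n \<rho> (\<lambda>i. U $$ (i, a))) = p a" if "a < n" for a
    using quadratic_form_eigenvector[OF U that] by simp
  have "\<forall>a<n. Re (quadratic_form n \<rho> (\<lambda>i. U $$ (i, a))) \<noteq> 0 \<longrightarrow> 0 < p a"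
    using p(1) by (simp add: R order_less_le)
  moreover have "(\<Sum>a<n. Re (quadratic_form n \<rho> (\<lambda>i. U $$ (i, a))) * ln (p a)) = - vn_entropy \<rho>"
    using vn_entropy_diagonalized[OF U] by (simp add: R)
  ultimately show ?thesis
    unfolding has_cross_entropy_def using U p by blast
qed

text \<open>Every choice of \<open>V\<close> and \<open>q\<close> diagonalizes
  \<open>\<rho>\<close>, and the entropy does not depend on that choice. This settles the product
  case of the equality statement.\<close>

lemma has_cross_entropy_selfD:
  assumes "has_cross_entropy n \<rho> \<rho> s"
  shows "s = vn_entropy \<rho>"
proof -
  obtain V q where V: "unitary_mat n V" "\<rho> = V * real_diag n q * mat_adjoint V"
    and s: "(\<Sum>b<n. Re (quadratic_form n \<rho> (\<lambda>i. V $$ (i, b))) * ln (q b)) = - s"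
    using assms unfolding has_cross_entropy_def by blast
  have "(\<Sum>b<n. Re (quadratic_form n \<rho> (\<lambda>i. V $$ (i, b))) * ln (q b)) = (\<Sum>b<n. q b * ln (q b))"
    using quadratic_form_eigenvector[OF V] by (intro sum.cong refl) simp
  then show ?thesis using s vn_entropy_diagonalized[OF V] by simp
qed

text \<open>The analytic core: \<open>s - vn_entropy \<rho>\<close> is the relative entropy of
  \<open>\<rho>\<close> with respect to \<open>\<sigma>\<close>. The Jensen bound is applied to the
  squared overlaps of the two eigenbases.\<close>

lemma vn_entropy_le_cross_entropy:
  assumes \<rho>: "density_matrix n \<rho>" and \<sigma>: "has_cross_entropy n \<rho> \<sigma> s"
  shows "0 < affinity \<rho> \<sigma>" "vn_entropy \<rho> - s \<le> 2 * ln (affinity \<rho> \<sigma>)"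
proof -
  obtain U p where U: "unitary_mat n U" "\<rho> = U * real_diag n p * mat_adjoint U" "\<forall>a<n. 0 \<le> p a"
    and p1: "(\<Sum>a<n. p a) = 1"
    using density_matrix_diagonalization[OF \<rho>] .
  obtain V q where V: "unitary_mat n V" "\<sigma> = V * real_diag n q * mat_adjoint V" "\<forall>b<n. 0 \<le> q b"
    and q1: "(\<Sum>b<n. q b) = 1"
    and ac: "\<forall>b<n. Re (quadratic_form n \<rho> (\<lambda>i. V $$ (i, b))) \<noteq> 0 \<longrightarrow> 0 < q b"
    and s: "(\<Sum>b<n. Re (quadratic_form n \<rho> (\<lambda>i. V $$ (i, b))) * ln (q b)) = - s"
    using \<sigma> unfolding has_cross_entropy_def by blast
  note u = unitary_matD[OF U(1)] and v = unitary_matD[OF V(1)]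
  have W: "unitary_mat n (mat_adjoint U * V)"
    by (intro unitary_mat_mult unitary_mat_adjoint U(1) V(1))
  define w where "w a b = (cmod ((mat_adjoint U * V) $$ (a, b)))\<^sup>2" for a b
  have R: "Re (quadratic_form n \<rho> (\<lambda>i. V $$ (i, b))) = (\<Sum>a<n. w a b * p a)" if "b < n" for b
    unfolding U(2) quadratic_form_diagonalized[OF u(1)] w_def using that
    by (simp add: index_adjoint_mult[OF u(1) v(1)] mult.commute del: of_real_sum index_mult_mat(1))
  have fid: "affinity \<rho> \<sigma> = (\<Sum>a<n. \<Sum>b<n. sqrt (p a) * sqrt (q b) * w a b)"
    unfolding w_def by (rule affinity_diagonalized[OF U V p1 q1])
  have w0: "0 \<le> w a b" for a b by (simp add: w_def)
  \<comment> \<open>The diagonal entry of \<open>\<rho>\<close> at \<open>b\<close> is a sum of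
    nonnegative terms, so one nonzero term makes it positive and the support condition
    applies.\<close>
  have ac': "0 < q b" if "a < n" "b < n" "w a b * p a \<noteq> 0" for a b
  proof -
    have "0 < w a b * p a" using that w0[of a b] U(3) by (simp add: less_le)
    also have "\<dots> \<le> (\<Sum>a<n. w a b * p a)"
      using that w0 U(3) by (intro member_le_sum) auto
    finally show ?thesis using ac R[OF that(2)] that(2) by simp
  qed
  have w1: "(\<Sum>b<n. w a b) = 1" and w2: "(\<Sum>b<n. w b a) = 1" if "a < n" for a
    unfolding w_def by (rule unitary_row_weight[OF W that], rule unitary_column_weight[OF W that])
  note jensen = sum_sqrt_weights_ge[of n w p q, folded fid]
  show "0 < affinity \<rho> \<sigma>"
    by (rule jensen(1)) (use w0 U(3) V(3) ac' w1 w2 p1 in auto)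
  have "(\<Sum>a<n. \<Sum>b<n. w a b * p a * ln (q b)) = - s"
    unfolding s[symmetric] by (subst sum.swap) (simp add: R sum_distrib_right)
  moreover have "(\<Sum>a<n. \<Sum>b<n. w a b * p a * ln (q b)) - (\<Sum>a<n. p a * ln (p a)) \<le> 2 * ln (affinity \<rho> \<sigma>)"
    by (rule jensen(2)) (use w0 U(3) V(3) ac' w1 w2 p1 in auto)
  ultimately show "vn_entropy \<rho> - s \<le> 2 * ln (affinity \<rho> \<sigma>)"
    using vn_entropy_diagonalized[OF U(1,2)] by simp
qed

lemma affinity_le_1:
  assumes "density_matrix n \<rho>" "has_cross_entropy n \<rho> \<sigma> s"
  shows "affinity \<rho> \<sigma> \<le> 1" "affinity \<rho> \<sigma> = 1 \<Longrightarrow> \<rho> = \<sigma>"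
proof -
  obtain U p where U: "unitary_mat n U" "\<rho> = U * real_diag n p * mat_adjoint U" "\<forall>a<n. 0 \<le> p a"
    using density_matrix_diagonalization[OF assms(1)] .
  obtain V q where V: "unitary_mat n V" "\<sigma> = V * real_diag n q * mat_adjoint V" "\<forall>b<n. 0 \<le> q b"
    using assms(2) unfolding has_cross_entropy_def by blast
  show "affinity \<rho> \<sigma> \<le> 1" "affinity \<rho> \<sigma> = 1 \<Longrightarrow> \<rho> = \<sigma>"
    by (fact affinity_extremal[OF U V])+
qed

text \<open>The logarithm of a product eigenvalue splits into a sum, and each part sees only one
  marginal of \<open>R\<close>. An arbitrary \<open>\<sigma>\<close> on the second factor allows
  iteration over many factors.\<close>

lemma has_cross_entropy_kron:
  assumes \<rho>: "density_matrix (m * n) \<rho>" and \<sigma>: "has_cross_entropy n (reduced_snd m n \<rho>) \<sigma> s"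
  shows "has_cross_entropy (m * n) \<rho> (reduced_fst m n \<rho> \<otimes>\<^sub>m \<sigma>) (vn_entropy (reduced_fst m n \<rho>) + s)"
proof -
  let ?\<rho>1 = "reduced_fst m n \<rho>" and ?\<rho>2 = "reduced_snd m n \<rho>"
  have c: "\<rho> \<in> carrier_mat (m * n) (m * n)" and pos: "\<And>x. 0 \<le> Re (quadratic_form (m * n) \<rho> x)"
    using \<rho> by (auto simp: density_matrix_def positive_semidefinite_iff)
  obtain U p where U: "unitary_mat m U" "?\<rho>1 = U * real_diag m p * mat_adjoint U"
    and p0: "\<forall>a<m. 0 \<le> p a" and p1: "(\<Sum>a<m. p a) = 1"
    using density_matrix_diagonalization[OF density_matrix_reduced_fst[OF \<rho>]] .
  obtain V q where V: "unitary_mat n V" "\<sigma> = V * real_diag n q * mat_adjoint V"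
    and q0: "\<forall>b<n. 0 \<le> q b" and q1: "(\<Sum>b<n. q b) = 1"
    and ac: "\<forall>b<n. Re (quadratic_form n ?\<rho>2 (\<lambda>i. V $$ (i, b))) \<noteq> 0 \<longrightarrow> 0 < q b"
    and s: "(\<Sum>b<n. Re (quadratic_form n ?\<rho>2 (\<lambda>i. V $$ (i, b))) * ln (q b)) = - s"
    using \<sigma> unfolding has_cross_entropy_def by blast
  note u = unitary_matD[OF U(1)] and v = unitary_matD[OF V(1)]
  define R where "R a b = Re (quadratic_form (m * n) \<rho> (\<lambda>i. U $$ (i div n, a) * V $$ (i mod n, b)))" for a b
  define R2 where "R2 b = Re (quadratic_form n ?\<rho>2 (\<lambda>i. V $$ (i, b)))" for b
  have R0: "0 \<le> R a b" for a b unfolding R_def by (rule pos)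
  \<comment> \<open>Summing over the whole basis \<open>V\<close> performs the partial trace over
    the second factor, and what remains is diagonal in \<open>U\<close>.\<close>
  have marg1: "(\<Sum>b<n. R a b) = p a" if "a < m" for a
  proof -
    have "(\<Sum>b<n. quadratic_form (m * n) \<rho> (\<lambda>i. U $$ (i div n, a) * V $$ (i mod n, b)))
        = quadratic_form m ?\<rho>1 (\<lambda>i. U $$ (i, a))"
      by (rule quadratic_form_reduced_fst[OF c, where r = n and y = "\<lambda>k b. V $$ (k, b)"]) (rule unitary_rows[OF V(1)])
    also have "\<dots> = complex_of_real (p a)" by (rule quadratic_form_eigenvector[OF U that])
    finally show ?thesis unfolding R_def by (simp flip: Re_sum)
  qed
  have marg2: "(\<Sum>a<m. R a b) = R2 b" for b
  proof -
    have "(\<Sum>a<m. quadratic_form (m * n) \<rho> (\<lambda>i. U $$ (i div n, a) * V $$ (i mod n, b)))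
        = quadratic_form n ?\<rho>2 (\<lambda>i. V $$ (i, b))"
      by (rule quadratic_form_reduced_snd[OF c, where r = m and x = "\<lambda>i a. U $$ (i, a)"]) (rule unitary_rows[OF U(1)])
    then show ?thesis unfolding R_def R2_def by (simp flip: Re_sum)
  qed
  \<comment> \<open>Each marginal dominates the joint probability \<open>R a b\<close>, so neither
    eigenvalue can vanish where \<open>R\<close> is nonzero.\<close>
  have pq: "0 < p a \<and> 0 < q b" if "a < m" "b < n" "R a b \<noteq> 0" for a b
  proof -
    have "0 < R a b" using that R0[of a b] by simp
    moreover have "R a b \<le> p a" unfolding marg1[OF that(1), symmetric]
      using that R0 by (intro member_le_sum) auto
    moreover have "R a b \<le> R2 b" unfolding marg2[symmetric]
      using that R0 by (intro member_le_sum[of a _ "\<lambda>a. R a b"]) auto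
    ultimately show ?thesis using ac that(2) unfolding R2_def by auto
  qed
  have col: "quadratic_form (m * n) \<rho> (\<lambda>i. (U \<otimes>\<^sub>m V) $$ (i, a * n + b))
      = quadratic_form (m * n) \<rho> (\<lambda>i. U $$ (i div n, a) * V $$ (i mod n, b))" if "a < m" "b < n" for a b
    unfolding quadratic_form_def
    by (intro sum.cong refl) (use that in \<open>simp add: index_kron[OF u(1) v(1)] mult_add_less\<close>)
  have sp: "vn_entropy ?\<rho>1 = - (\<Sum>a<m. p a * ln (p a))" by (rule vn_entropy_diagonalized[OF U])
  have "(\<Sum>c<m * n. Re (quadratic_form (m * n) \<rho> (\<lambda>i. (U \<otimes>\<^sub>m V) $$ (i, c))) * ln (p (c div n) * q (c mod n)))
      = (\<Sum>a<m. \<Sum>b<n. R a b * ln (p a * q b))"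
    unfolding sum_lessThan_mult by (intro sum.cong refl) (simp add: col R_def)
  \<comment> \<open>The logarithm is split only where \<open>R a b\<close> is nonzero and both
    eigenvalues are positive; elsewhere both sides are zero.\<close>
  also have "\<dots> = (\<Sum>a<m. \<Sum>b<n. R a b * ln (p a) + R a b * ln (q b))"
  proof (intro sum.cong refl)
    fix a b assume "a \<in> {..<m}" "b \<in> {..<n}"
    then show "R a b * ln (p a * q b) = R a b * ln (p a) + R a b * ln (q b)"
      using pq[of a b] by (cases "R a b = 0") (auto simp: ln_mult algebra_simps)
  qed
  also have "\<dots> = (\<Sum>a<m. p a * ln (p a)) + (\<Sum>b<n. \<Sum>a<m. R a b * ln (q b))"
    unfolding sum.distrib sum.swap[of "\<lambda>a b. R a b * ln (q b)"] by (simp add: marg1 flip: sum_distrib_right)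
  also have "\<dots> = - (vn_entropy ?\<rho>1 + s)"
    using s sp by (simp add: marg2 R2_def flip: sum_distrib_right)
  finally have e: "(\<Sum>c<m * n. Re (quadratic_form (m * n) \<rho> (\<lambda>i. (U \<otimes>\<^sub>m V) $$ (i, c))) * ln (p (c div n) * q (c mod n)))
      = - (vn_entropy ?\<rho>1 + s)" .
  have ac2: "0 < p (c div n) * q (c mod n)"
    if "c < m * n" "Re (quadratic_form (m * n) \<rho> (\<lambda>i. (U \<otimes>\<^sub>m V) $$ (i, c))) \<noteq> 0" for c
    using that pq[of "c div n" "c mod n"] col[of "c div n" "c mod n"] div_mod_less[OF that(1)]
    by (simp add: R_def)
  have "(\<Sum>c<m * n. p (c div n) * q (c mod n)) = 1"
    unfolding sum_lessThan_mult using p1 q1 by (simp flip: sum_distrib_left sum_distrib_right)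
  moreover have "\<forall>c<m * n. 0 \<le> p (c div n) * q (c mod n)"
    using p0 q0 div_mod_less by simp
  moreover have "?\<rho>1 \<otimes>\<^sub>m \<sigma> = (U \<otimes>\<^sub>m V) * real_diag (m * n) (\<lambda>i. p (i div n) * q (i mod n)) * mat_adjoint (U \<otimes>\<^sub>m V)"
    unfolding U(2) V(2) by (rule kron_diagonalized[OF u(1) v(1)])
  ultimately show ?thesis
    unfolding has_cross_entropy_def
    using unitary_mat_kron[OF U(1) V(1)] e ac2 by blast
qed

section \<open>Reduced matrices of several tensor factors\<close>

lemma reduced_snd_one:
  assumes "\<rho> \<in> carrier_mat n n"
  shows "reduced_snd 1 n \<rho> = \<rho>"
  using assms by (intro eq_matI) (auto simp: reduced_snd_def)

text \<open>No factor precedes the first one, so the left group has dimension 1 and tracing it out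
  changes nothing.\<close>

lemma reduced_Cons_0:
  assumes "\<rho> \<in> carrier_mat (prod_list (d # ds)) (prod_list (d # ds))"
  shows "reduced (d # ds) 0 \<rho> = reduced_fst d (prod_list ds) \<rho>"
  using reduced_snd_one[OF assms] by (simp add: reduced_def)

text \<open>Tensor numbering is associative: \<open>a * (l * n) + (i * n + k)\<close> equals
  \<open>(a * l + i) * n + k\<close>, and \<open>a * l + i\<close> runs through the merged
  group.\<close>

lemma reduced_snd_reduced_snd:
  "reduced_snd l n (reduced_snd d (l * n) \<rho>) = reduced_snd (d * l) n \<rho>"
proof (rule eq_matI)
  fix k j assume "k < dim_row (reduced_snd (d * l) n \<rho>)" "j < dim_col (reduced_snd (d * l) n \<rho>)"
  then have kj: "k < n" "j < n" by (simp_all add: reduced_snd_def)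
  have "reduced_snd l n (reduced_snd d (l * n) \<rho>) $$ (k, j)
      = (\<Sum>i<l. \<Sum>a<d. \<rho> $$ (a * (l * n) + (i * n + k), a * (l * n) + (i * n + j)))"
    using kj by (simp add: reduced_snd_def mult_add_less)
  also have "\<dots> = (\<Sum>a<d. \<Sum>i<l. \<rho> $$ ((a * l + i) * n + k, (a * l + i) * n + j))"
    by (subst sum.swap) (simp add: algebra_simps)
  also have "\<dots> = reduced_snd (d * l) n \<rho> $$ (k, j)"
    using kj by (simp add: reduced_snd_def sum_lessThan_mult)
  finally show "reduced_snd l n (reduced_snd d (l * n) \<rho>) $$ (k, j) = reduced_snd (d * l) n \<rho> $$ (k, j)" .
qed (simp_all add: reduced_snd_def)

lemma reduced_Cons_Suc:
  assumes "j < length ds"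
  shows "reduced (d # ds) (Suc j) \<rho> = reduced ds j (reduced_snd d (prod_list ds) \<rho>)"
proof -
  have "prod_list ds = prod_list (take j ds) * (ds ! j * prod_list (drop (Suc j) ds))"
    using arg_cong[OF id_take_nth_drop[OF assms], of prod_list] by simp
  then show ?thesis
    unfolding reduced_def Let_def by (simp add: reduced_snd_reduced_snd)
qed

text \<open>Induction on the factors: the first one is split off by
  \<open>has_cross_entropy_kron\<close>, and the hypothesis is applied to the matrix left after
  tracing it out, whose reduced matrices are those of \<open>\<rho>\<close>.\<close>

lemma has_cross_entropy_kron_list:
  assumes "density_matrix (prod_list ds) \<rho>"
  shows "has_cross_entropy (prod_list ds) \<rho> (kron_list (map (\<lambda>j. reduced ds j \<rho>) [0..<length ds]))
    (\<Sum>j<length ds. vn_entropy (reduced ds j \<rho>))"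
  using assms
proof (induction ds arbitrary: \<rho>)
  case Nil
  \<comment> \<open>The empty product is one-dimensional with the single eigenvalue 1, whose
    logarithm is 0.\<close>
  have "unitary_mat 1 (1\<^sub>m 1)" by (intro unitary_matI eq_matI) (simp_all add: index_mat_adjoint scalar_prod_def)
  moreover have "1\<^sub>m 1 = 1\<^sub>m 1 * real_diag 1 (\<lambda>_. 1) * mat_adjoint (1\<^sub>m 1)"
    by (intro eq_matI) (simp_all add: index_mat_adjoint scalar_prod_def index_real_diag)
  ultimately have "has_cross_entropy 1 \<rho> (1\<^sub>m 1) 0"
    unfolding has_cross_entropy_def by (intro exI[of _ "1\<^sub>m 1"] exI[of _ "\<lambda>_. 1"]) simp
  then show ?case by simp
next
  case (Cons d ds)
  let ?\<rho>2 = "reduced_snd d (prod_list ds) \<rho>"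
  have \<rho>: "density_matrix (d * prod_list ds) \<rho>" using Cons.prems by simp
  then have c: "\<rho> \<in> carrier_mat (prod_list (d # ds)) (prod_list (d # ds))"
    by (simp add: density_matrix_def positive_semidefinite_def)
  have "map (\<lambda>j. reduced (d # ds) j \<rho>) [0..<length (d # ds)]
      = reduced_fst d (prod_list ds) \<rho> # map (\<lambda>j. reduced ds j ?\<rho>2) [0..<length ds]"
    by (simp add: upt_conv_Cons reduced_Cons_0[OF c] reduced_Cons_Suc flip: map_Suc_upt del: upt_Suc)
  moreover have "(\<Sum>j<length (d # ds). vn_entropy (reduced (d # ds) j \<rho>))
      = vn_entropy (reduced_fst d (prod_list ds) \<rho>) + (\<Sum>j<length ds. vn_entropy (reduced ds j ?\<rho>2))"
    by (simp add: sum.lessThan_Suc_shift reduced_Cons_0[OF c] reduced_Cons_Suc del: sum.lessThan_Suc)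
  ultimately show ?case
    using has_cross_entropy_kron[OF \<rho> Cons.IH[OF density_matrix_reduced_snd[OF \<rho>]]] by simp
qed

section \<open>Subadditivity of the entropy with a remainder term, and its equality case\<close>

theorem theorem5p1:
  shows "(\<forall>d1 d2 \<rho>12 \<rho>1 \<rho>2.
      density_matrix (d1 * d2) \<rho>12 \<and>
      \<rho>1 = reduced_fst d1 d2 \<rho>12 \<and> \<rho>2 = reduced_snd d1 d2 \<rho>12 \<longrightarrow>
        0 < 1 - 1 / 2 * Re (mat_trace ((mat_sqrt \<rho>12 - mat_sqrt (\<rho>1 \<otimes>\<^sub>m \<rho>2)) ^\<^sub>m 2)) \<and>
        vn_entropy \<rho>12 - vn_entropy \<rho>1 - vn_entropy \<rho>2
          \<le> 2 * ln (1 - 1 / 2 * Re (mat_trace ((mat_sqrt \<rho>12 - mat_sqrt (\<rho>1 \<otimes>\<^sub>m \<rho>2)) ^\<^sub>m 2))) \<and>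
        0 \<le> vn_entropy \<rho>1 + vn_entropy \<rho>2 - vn_entropy \<rho>12 \<and>
        (vn_entropy \<rho>1 + vn_entropy \<rho>2 - vn_entropy \<rho>12 = 0 \<longleftrightarrow> \<rho>12 = \<rho>1 \<otimes>\<^sub>m \<rho>2))
    \<and>
    (\<forall>ds \<rho> \<rho>s.
      ds \<noteq> [] \<and> density_matrix (prod_list ds) \<rho> \<and>
      \<rho>s = map (\<lambda>j. reduced ds j \<rho>) [0..<length ds] \<longrightarrow>
        0 < 1 - 1 / 2 * Re (mat_trace ((mat_sqrt \<rho> - mat_sqrt (kron_list \<rho>s)) ^\<^sub>m 2)) \<and>
        vn_entropy \<rho> - (\<Sum>j<length ds. vn_entropy (\<rho>s ! j))
          \<le> 2 * ln (1 - 1 / 2 * Re (mat_trace ((mat_sqrt \<rho> - mat_sqrt (kron_list \<rho>s)) ^\<^sub>m 2))))"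
  unfolding affinity_def[symmetric]
proof (intro conjI allI impI; elim conjE; hypsubst)
  fix d1 d2 :: nat and \<rho> :: "complex mat"
  assume \<rho>: "density_matrix (d1 * d2) \<rho>"
  let ?\<rho>1 = "reduced_fst d1 d2 \<rho>" and ?\<rho>2 = "reduced_snd d1 d2 \<rho>"
  have ce: "has_cross_entropy (d1 * d2) \<rho> (?\<rho>1 \<otimes>\<^sub>m ?\<rho>2) (vn_entropy ?\<rho>1 + vn_entropy ?\<rho>2)"
    by (intro has_cross_entropy_kron has_cross_entropy_self density_matrix_reduced_snd \<rho>)
  note bound = vn_entropy_le_cross_entropy[OF \<rho> ce]
  \<comment> \<open>A positive argument ensures that the bound does not rest on a default value of
    \<open>ln\<close>.\<close>
  show "0 < affinity \<rho> (?\<rho>1 \<otimes>\<^sub>m ?\<rho>2)" by (rule bound(1))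
  show le: "vn_entropy \<rho> - vn_entropy ?\<rho>1 - vn_entropy ?\<rho>2 \<le> 2 * ln (affinity \<rho> (?\<rho>1 \<otimes>\<^sub>m ?\<rho>2))"
    using bound(2) by simp
  have "ln (affinity \<rho> (?\<rho>1 \<otimes>\<^sub>m ?\<rho>2)) \<le> 0"
    using bound(1) affinity_le_1(1)[OF \<rho> ce] by simp
  then show "0 \<le> vn_entropy ?\<rho>1 + vn_entropy ?\<rho>2 - vn_entropy \<rho>" using le by simp
  show "vn_entropy ?\<rho>1 + vn_entropy ?\<rho>2 - vn_entropy \<rho> = 0 \<longleftrightarrow> \<rho> = ?\<rho>1 \<otimes>\<^sub>m ?\<rho>2"
  proof
    assume "vn_entropy ?\<rho>1 + vn_entropy ?\<rho>2 - vn_entropy \<rho> = 0"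
    \<comment> \<open>If the left side of the bound is zero, the logarithm cannot be negative, which
      forces the affinity up to its maximum 1.\<close>
    then have "0 \<le> ln (affinity \<rho> (?\<rho>1 \<otimes>\<^sub>m ?\<rho>2))" using le by simp
    then have "affinity \<rho> (?\<rho>1 \<otimes>\<^sub>m ?\<rho>2) = 1"
      using bound(1) affinity_le_1(1)[OF \<rho> ce] by (simp add: ln_ge_zero_iff)
    then show "\<rho> = ?\<rho>1 \<otimes>\<^sub>m ?\<rho>2" by (rule affinity_le_1(2)[OF \<rho> ce])
  next
    assume eq: "\<rho> = ?\<rho>1 \<otimes>\<^sub>m ?\<rho>2"
    \<comment> \<open>For a product state, \<open>ce\<close> is the cross entropy of
      \<open>\<rho>\<close> with itself, so its value must be
      \<open>vn_entropy \<rho>\<close>.\<close>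
    show "vn_entropy ?\<rho>1 + vn_entropy ?\<rho>2 - vn_entropy \<rho> = 0"
      using has_cross_entropy_selfD[OF ce[folded eq]] by simp
  qed
next
  fix ds \<rho>
  assume \<rho>: "density_matrix (prod_list ds) \<rho>"
  let ?\<rho>s = "map (\<lambda>j. reduced ds j \<rho>) [0..<length ds]"
  note bound = vn_entropy_le_cross_entropy[OF \<rho> has_cross_entropy_kron_list[OF \<rho>]]
  show "0 < affinity \<rho> (kron_list ?\<rho>s)" by (rule bound(1))
  show "vn_entropy \<rho> - (\<Sum>j<length ds. vn_entropy (?\<rho>s ! j)) \<le> 2 * ln (affinity \<rho> (kron_list ?\<rho>s))"
    using bound(2) by simp
qed

end
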